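(* Let $a,b,c,d,e,m$ be nonnegative integers, let $\pi=\Lambda(a,b,c,d,e,m)=\lambda/b^a$ be as in the context, and let $N=\sum_{(i,j)\in\lambda/b^a}(\lambda'_j-i)$. Then \[ s_{\pi}(1,q,q^2,\ldots)=q^{N}\prod_{i=1}^{a}\prod_{j=1}^{b}\prod_{k=1}^{c}\frac{1-q^{(m+1)(i+j+k-1)}}{1-q^{(m+1)(i+j+k-2)}}\;\prod_{(i,j)\in\lambda/(0^cb^a)}\frac{1}{1-q^{h_\lambda(i,j)}}. \]
   Context: Cells $(i,j)$: row $i$, column $j$. $\lambda'$ is the conjugate partition, $h_\lambda(i,j)=\lambda_i-i+\lambda'_j-j+1$ the hook length. $s_{\lambda/\mu}(1,q,q^2,\ldots)=\sum_T q^{\sum_{u}(T(u)-1)}$, the sum over semistandard Young tableaux $T$ of shape $\lambda/\mu$ with positive integer entries. The shape $\Lambda(a,b,c,d,e,m)$: set $\nu_i=d+(a+c-i)m$ ($1\le i\le a+c$), $\theta_j=e+(b+c-j)m$ ($1\le j\le b+c$); $\lambda$ is the partition whose diagram consists of cells $(i,j)$ with either ($i\le a+c$ and $j\le b+c+\nu_i$) or ($j\le b+c$ and $i\le a+c+\theta_j$); $\Lambda(a,b,c,d,e,m)=\lambda/b^a$ with $b^a=(b,\dots,b)$ ($a$ parts). The set $\lambda/(0^cb^a)$ denotes the cells of $\lambda$ not in $\{(i,j): c+1\le i\le c+a,\ 1\le j\le b\}$. *)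

theory Defs
  imports "HOL-Analysis.Analysis"
begin

text \<open>
  A partition is represented by its sequence of parts, indexed from \<open>1\<close>; the value at index \<open>0\<close>
  is irrelevant. Cells are pairs (row, column), both counted from \<open>1\<close>.
\<close>

definition is_partition :: "(nat \<Rightarrow> nat) \<Rightarrow> bool" where
  "is_partition lam \<longleftrightarrow>
     (\<forall>i j. 1 \<le> i \<longrightarrow> i \<le> j \<longrightarrow> lam j \<le> lam i) \<and> finite {i. 1 \<le> i \<and> lam i \<noteq> 0}"

definition diagram :: "(nat \<Rightarrow> nat) \<Rightarrow> (nat \<times> nat) set" where
  "diagram lam = {(i, j). 1 \<le> i \<and> 1 \<le> j \<and> j \<le> lam i}"

definition conjugate :: "(nat \<Rightarrow> nat) \<Rightarrow> nat \<Rightarrow> nat" where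
  "conjugate lam j = card {i. 1 \<le> i \<and> j \<le> lam i}"

definition parts_of :: "(nat \<times> nat) set \<Rightarrow> nat \<Rightarrow> nat" where
  "parts_of D i = card {j. (i, j) \<in> D}"

text \<open>The partition \<open>b\<^sup>a\<close> with \<open>a\<close> parts equal to \<open>b\<close>.\<close>

definition rect :: "nat \<Rightarrow> nat \<Rightarrow> nat \<Rightarrow> nat" where
  "rect b a i = (if 1 \<le> i \<and> i \<le> a then b else 0)"

text \<open>Computed in the integers because \<open>lam i - i\<close> may be negative; positive on cells of \<open>lam\<close>.\<close>

definition hook_length :: "(nat \<Rightarrow> nat) \<Rightarrow> nat \<Rightarrow> nat \<Rightarrow> nat" where
  "hook_length lam i j = nat (int (lam i) - int i + int (conjugate lam j) - int j + 1)"

definition skew_diagram :: "(nat \<Rightarrow> nat) \<Rightarrow> (nat \<Rightarrow> nat) \<Rightarrow> (nat \<times> nat) set" where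
  "skew_diagram lam mu = diagram lam - diagram mu"

definition SSYT :: "(nat \<times> nat) set \<Rightarrow> (nat \<times> nat \<Rightarrow> nat) set" where
  "SSYT S = {T \<in> S \<rightarrow>\<^sub>E {1..}.
     (\<forall>i j j'. (i, j) \<in> S \<longrightarrow> (i, j') \<in> S \<longrightarrow> j < j' \<longrightarrow> T (i, j) \<le> T (i, j')) \<and>
     (\<forall>i i' j. (i, j) \<in> S \<longrightarrow> (i', j) \<in> S \<longrightarrow> i < i' \<longrightarrow> T (i, j) < T (i', j))}"

text \<open>
  The principal specialization \<open>s\<^bsub>lam/mu\<^esub>(1, q, q\<^sup>2, \<dots>)\<close> as a formal power series in
  \<open>q = fps_X\<close>; the sum over tableaux converges for every finite shape (lemma \<open>has_sum_SSYT\<close>).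
\<close>

definition skew_schur_ps :: "(nat \<Rightarrow> nat) \<Rightarrow> (nat \<Rightarrow> nat) \<Rightarrow> rat fps" where
  "skew_schur_ps lam mu =
     infsum (\<lambda>T. fps_X ^ (\<Sum>u\<in>skew_diagram lam mu. T u - 1)) (SSYT (skew_diagram lam mu))"

definition Lambda_nu :: "nat \<Rightarrow> nat \<Rightarrow> nat \<Rightarrow> nat \<Rightarrow> nat \<Rightarrow> nat" where
  "Lambda_nu a c d m i = d + (a + c - i) * m"

definition Lambda_theta :: "nat \<Rightarrow> nat \<Rightarrow> nat \<Rightarrow> nat \<Rightarrow> nat \<Rightarrow> nat" where
  "Lambda_theta b c e m j = e + (b + c - j) * m"

definition Lambda_cells :: "nat \<Rightarrow> nat \<Rightarrow> nat \<Rightarrow> nat \<Rightarrow> nat \<Rightarrow> nat \<Rightarrow> (nat \<times> nat) set" where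
  "Lambda_cells a b c d e m = {(i, j). 1 \<le> i \<and> 1 \<le> j \<and>
     (i \<le> a + c \<and> j \<le> b + c + Lambda_nu a c d m i \<or>
      j \<le> b + c \<and> i \<le> a + c + Lambda_theta b c e m j)}"

text \<open>The outer partition \<open>lam\<close> of the skew shape \<open>\<Lambda>(a,b,c,d,e,m) = lam/b\<^sup>a\<close>.\<close>

definition Lambda_outer :: "nat \<Rightarrow> nat \<Rightarrow> nat \<Rightarrow> nat \<Rightarrow> nat \<Rightarrow> nat \<Rightarrow> nat \<Rightarrow> nat" where
  "Lambda_outer a b c d e m = parts_of (Lambda_cells a b c d e m)"

lemma finite_Lambda_cells: "finite (Lambda_cells a b c d e m)"
proof (rule finite_subset)
  show "Lambda_cells a b c d e m \<subseteq>
      {..a + c + (e + (b + c) * m)} \<times> {..b + c + (d + (a + c) * m)}"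
  proof (clarsimp simp: Lambda_cells_def Lambda_nu_def Lambda_theta_def)
    fix i j
    assume h: "i \<le> a + c \<and> j \<le> b + c + (d + (a + c - i) * m) \<or>
      j \<le> b + c \<and> i \<le> a + c + (e + (b + c - j) * m)"
    have "(a + c - i) * m \<le> (a + c) * m" "(b + c - j) * m \<le> (b + c) * m"
      by (simp_all add: mult_le_mono1)
    with h show "i \<le> a + c + (e + (b + c) * m) \<and> j \<le> b + c + (d + (a + c) * m)"
      by linarith
  qed
qed simp

lemma Lambda_cells_down:
  assumes "(i, j) \<in> Lambda_cells a b c d e m" "1 \<le> i'" "i' \<le> i" "1 \<le> j'" "j' \<le> j"
  shows "(i', j') \<in> Lambda_cells a b c d e m"
proof -
  have "(a + c - i) * m \<le> (a + c - i') * m" "(b + c - j) * m \<le> (b + c - j') * m"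
    using assms by (auto intro!: mult_le_mono1 diff_le_mono2)
  then show ?thesis
    using assms unfolding Lambda_cells_def Lambda_nu_def Lambda_theta_def mem_Collect_eq prod.case
    by linarith
qed

lemma Lambda_cells_row:
  "{j. (i, j) \<in> Lambda_cells a b c d e m} = {1..Lambda_outer a b c d e m i}"
proof -
  let ?R = "{j. (i, j) \<in> Lambda_cells a b c d e m}"
  have fin: "finite ?R"
    by (rule finite_subset[of _ "snd ` Lambda_cells a b c d e m"])
       (force simp: finite_Lambda_cells)+
  show ?thesis
  proof (cases "?R = {}")
    case True
    then show ?thesis by (simp add: Lambda_outer_def parts_of_def)
  next
    case False
    have mx: "Max ?R \<in> ?R" using fin False by (rule Max_in)
    have "?R = {1..Max ?R}"
    proof (intro set_eqI iffI)
      fix j assume "j \<in> ?R"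
      then show "j \<in> {1..Max ?R}" using fin by (auto simp: Lambda_cells_def)
    next
      fix j assume "j \<in> {1..Max ?R}"
      then show "j \<in> ?R" using mx Lambda_cells_down[of i "Max ?R" a b c d e m i j]
        by (auto simp: Lambda_cells_def)
    qed
    then have "card ?R = Max ?R" by (metis card_atLeastAtMost diff_Suc_1)
    with \<open>?R = {1..Max ?R}\<close> show ?thesis by (simp add: Lambda_outer_def parts_of_def)
  qed
qed

lemma diagram_Lambda_outer: "diagram (Lambda_outer a b c d e m) = Lambda_cells a b c d e m"
proof (intro set_eqI iffI; clarify)
  fix i j
  assume "(i, j) \<in> diagram (Lambda_outer a b c d e m)"
  then have "j \<in> {1..Lambda_outer a b c d e m i}" by (simp add: diagram_def)
  then show "(i, j) \<in> Lambda_cells a b c d e m" using Lambda_cells_row[of i a b c d e m] by blast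
next
  fix i j
  assume h: "(i, j) \<in> Lambda_cells a b c d e m"
  then have "j \<in> {1..Lambda_outer a b c d e m i}" using Lambda_cells_row[of i a b c d e m] by blast
  with h show "(i, j) \<in> diagram (Lambda_outer a b c d e m)"
    by (simp add: diagram_def Lambda_cells_def)
qed

lemma is_partition_Lambda_outer: "is_partition (Lambda_outer a b c d e m)"
  unfolding is_partition_def
proof (intro conjI allI impI)
  fix i j :: nat
  assume "1 \<le> i" "i \<le> j"
  have "{k. (j, k) \<in> Lambda_cells a b c d e m} \<subseteq> {k. (i, k) \<in> Lambda_cells a b c d e m}"
  proof clarify
    fix k assume k: "(j, k) \<in> Lambda_cells a b c d e m"
    then have "1 \<le> k" by (simp add: Lambda_cells_def)
    with k \<open>1 \<le> i\<close> \<open>i \<le> j\<close> show "(i, k) \<in> Lambda_cells a b c d e m"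
      using Lambda_cells_down by blast
  qed
  then show "Lambda_outer a b c d e m j \<le> Lambda_outer a b c d e m i"
    by (cases "Lambda_outer a b c d e m j") (simp_all add: Lambda_cells_row)
next
  have "{i. 1 \<le> i \<and> Lambda_outer a b c d e m i \<noteq> 0} \<subseteq> fst ` Lambda_cells a b c d e m"
    unfolding diagram_Lambda_outer[symmetric] by (force simp: diagram_def)
  then show "finite {i. 1 \<le> i \<and> Lambda_outer a b c d e m i \<noteq> 0}"
    by (rule finite_subset) (simp add: finite_Lambda_cells)
qed

lemma finite_SSYT_weight:
  assumes "finite S"
  shows "finite {T \<in> SSYT S. (\<Sum>u\<in>S. T u - 1) = n}"
proof (rule finite_subset)
  show "{T \<in> SSYT S. (\<Sum>u\<in>S. T u - 1) = n} \<subseteq> S \<rightarrow>\<^sub>E {..n + 1}"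
  proof
    fix T assume T: "T \<in> {T \<in> SSYT S. (\<Sum>u\<in>S. T u - 1) = n}"
    have "T u \<le> n + 1" if "u \<in> S" for u
      using member_le_sum[of u S "\<lambda>u. T u - 1"] that assms T by auto
    with T show "T \<in> S \<rightarrow>\<^sub>E {..n + 1}" by (auto simp: SSYT_def PiE_iff)
  qed
qed (use assms in \<open>simp add: finite_PiE\<close>)

lemma has_sum_SSYT:
  assumes "finite S"
  shows "((\<lambda>T. fps_X ^ (\<Sum>u\<in>S. T u - 1)) has_sum
     Abs_fps (\<lambda>n. of_nat (card {T \<in> SSYT S. (\<Sum>u\<in>S. T u - 1) = n}) :: rat)) (SSYT S)"
  unfolding has_sum_def tendsto_fps_iff
proof
  fix n
  let ?w = "\<lambda>T. \<Sum>u\<in>S. T u - 1"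
  let ?A = "{T \<in> SSYT S. ?w T = n}"
  have fin: "finite ?A" by (rule finite_SSYT_weight[OF assms])
  show "\<forall>\<^sub>F F in finite_subsets_at_top (SSYT S).
     fps_nth (\<Sum>T\<in>F. fps_X ^ ?w T) n = fps_nth (Abs_fps (\<lambda>n. of_nat (card {T \<in> SSYT S. ?w T = n}) :: rat)) n"
    unfolding eventually_finite_subsets_at_top
  proof (intro exI[of _ ?A] conjI allI impI)
    fix F assume F: "finite F \<and> ?A \<subseteq> F \<and> F \<subseteq> SSYT S"
    have "fps_nth (\<Sum>T\<in>F. fps_X ^ ?w T :: rat fps) n = (\<Sum>T\<in>F. if ?w T = n then 1 else 0)"
      by (auto simp: fps_sum_nth intro!: sum.cong)
    also have "\<dots> = of_nat (card {T \<in> F. ?w T = n})"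
      using F by (simp add: sum.If_cases Int_def)
    also have "{T \<in> F. ?w T = n} = ?A" using F by auto
    finally show "fps_nth (\<Sum>T\<in>F. fps_X ^ ?w T) n =
      fps_nth (Abs_fps (\<lambda>n. of_nat (card {T \<in> SSYT S. ?w T = n}) :: rat)) n" by simp
  qed (use fin in auto)
qed

end

theory Submission
  imports "Jordan_Normal_Form.Determinant"
    "HOL-Computational_Algebra.Formal_Laurent_Series" Defs
begin

text \<open>
  Removing the entries \<open>1\<close> of a tableau of shape \<open>lam/mu\<close> expresses its generating function through
  those of \<open>lam/nu\<close>, \<open>nu/mu\<close> a horizontal strip. The Jacobi-Trudi determinant
  \<open>det [1 / (q; q)\<^bsub>l i - k j\<^esub>]\<close> satisfies the same recurrence: subtract neighbouring rows and expand.

  Up to row and column factors its entries are \<open>f\<^bsub>k\<^esub>(q\<^bsup>l\<^esup>)\<close> with \<open>f\<^bsub>k\<^esub>(x) = (x - 1)(x - q)\<dots>(x - q\<^bsup>k-1\<^esup>)\<close>.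
  For \<open>mu = b\<^bsup>a\<^esup>\<close> a change of polynomial basis splits off a Vandermonde determinant, which gives the
  hook product of \<open>lam\<close>, and leaves a determinant of size \<open>a + c\<close> with columns \<open>x\<^bsup>r\<^esup>\<close> (\<open>r < c\<close>) and
  \<open>Q(x) x\<^bsup>t\<^esup>\<close> (\<open>t < a\<close>). In the shape \<open>\<Lambda>\<close> both the points \<open>x\<close> and the roots of \<open>Q\<close> are geometric
  progressions with ratio \<open>q\<^bsup>m+1\<^esup>\<close>, and \<open>q\<close>-differences remove the columns \<open>x\<^bsup>r\<^esup>\<close> one at a time.

  Determinants are only computed up to a factor \<open>\<plusminus>q\<^bsup>k\<^esup>\<close>; the factor is recovered at the end because the
  lowest term of the left-hand side comes from the minimal tableau and has degree \<open>N\<close>.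
\<close>

section \<open>Determinants\<close>

text \<open>Entries are a function on indices, so rows and columns can be shifted and rewritten
  without dimension side conditions.\<close>

definition Det :: "nat \<Rightarrow> (nat \<Rightarrow> nat \<Rightarrow> 'a) \<Rightarrow> 'a::comm_ring_1" where
  "Det n f = Determinant.det (Matrix.mat n n (\<lambda>(i, j). f i j))"

lemma Det_Leibniz:
  "Det n f = (\<Sum>p | p permutes {0..<n}. signof p * (\<Prod>i = 0..<n. f i (p i)))"
proof -
  have "p i < n" if "p permutes {0..<n}" "i < n" for p i
    using permutes_in_image[OF that(1), of i] that(2) by simp
  then show ?thesis
    unfolding Det_def by (subst det_def'[of _ n]) (auto intro!: sum.cong prod.cong)
qed

lemma Det_cong:
  assumes "\<And>i j. i < n \<Longrightarrow> j < n \<Longrightarrow> f i j = g i j"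
  shows "Det n f = Det n g"
  unfolding Det_def by (intro arg_cong[where f = Determinant.det] eq_matI) (auto simp: assms)

lemma Det_scale:
  "Det n (\<lambda>i j. r i * c j * f i j) = (\<Prod>i<n. r i) * (\<Prod>j<n. c j) * Det n f"
proof -
  have "(\<Prod>i = 0..<n. r i * c (p i) * f i (p i)) =
      (\<Prod>i<n. r i) * (\<Prod>j<n. c j) * (\<Prod>i = 0..<n. f i (p i))" if "p permutes {0..<n}" for p
    using prod.permute[OF that, of c] by (simp add: prod.distrib atLeast0LessThan comp_def)
  then show ?thesis
    by (auto simp: Det_Leibniz sum_distrib_left intro!: sum.cong)
qed

lemma Det_transpose: "Det n (\<lambda>i j. f j i) = Det n f"
proof -
  have "Matrix.mat n n (\<lambda>(i, j). f j i) = transpose_mat (Matrix.mat n n (\<lambda>(i, j). f i j))"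
    by (intro eq_matI) auto
  then show ?thesis unfolding Det_def by (simp add: Determinant.det_transpose[of _ n])
qed

lemma Det_mult:
  "Det n (\<lambda>i j. \<Sum>k<n. f i k * g k j) = Det n f * Det n g"
proof -
  have "Matrix.mat n n (\<lambda>(i, j). \<Sum>k<n. f i k * g k j) =
      Matrix.mat n n (\<lambda>(i, j). f i j) * Matrix.mat n n (\<lambda>(i, j). g i j)"
    by (intro eq_matI) (auto simp: scalar_prod_def atLeast0LessThan)
  then show ?thesis
    unfolding Det_def by (simp add: Determinant.det_mult[of _ n])
qed

lemma prod_list_diag_mat: "prod_list (diag_mat (Matrix.mat n n (\<lambda>(i, j). f i j))) = (\<Prod>i<n. f i i)"
  by (simp add: prod_list_diag_prod atLeast0LessThan)

lemma Det_lower_triangular: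
  assumes "\<And>i j. i < j \<Longrightarrow> j < n \<Longrightarrow> f i j = 0"
  shows "Det n f = (\<Prod>i<n. f i i)"
  unfolding Det_def by (subst det_lower_triangular[of n]) (auto simp: assms prod_list_diag_mat)

lemma Det_upper_triangular:
  assumes "\<And>i j. j < i \<Longrightarrow> i < n \<Longrightarrow> f i j = 0"
  shows "Det n f = (\<Prod>i<n. f i i)"
  unfolding Det_def
  by (subst Determinant.det_upper_triangular[of _ n]) (auto simp: assms prod_list_diag_mat upper_triangular_def)

lemma Det_block_lower_triangular:
  fixes f :: "nat \<Rightarrow> nat \<Rightarrow> 'a::idom"
  assumes "\<And>i j. i < n \<Longrightarrow> n \<le> j \<Longrightarrow> j < n + k \<Longrightarrow> f i j = 0"
  shows "Det (n + k) f = Det n f * Det k (\<lambda>i j. f (n + i) (n + j))"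
proof -
  let ?A = "Matrix.mat n n (\<lambda>(i, j). f i j)"
  let ?C = "Matrix.mat k n (\<lambda>(i, j). f (n + i) j)"
  let ?D = "Matrix.mat k k (\<lambda>(i, j). f (n + i) (n + j))"
  have "Matrix.mat (n + k) (n + k) (\<lambda>(i, j). f i j) = four_block_mat ?A (0\<^sub>m n k) ?C ?D"
    by (intro eq_matI) (auto simp: assms)
  then show ?thesis
    unfolding Det_def
    using det_four_block_mat_upper_right_zero[of ?A n "0\<^sub>m n k" k ?C ?D] by simp
qed

text \<open>Multilinearity in the rows: each row chooses one of its summands independently, whence
  the sum over \<open>PiE\<close>.\<close>

lemma Det_row_sums:
  assumes "\<And>i. i < n \<Longrightarrow> finite (T i)"
  shows "Det n (\<lambda>i j. \<Sum>t\<in>T i. g t j) = (\<Sum>t\<in>PiE {0..<n} T. Det n (\<lambda>i j. g (t i) j))"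
proof -
  have "(\<Prod>i = 0..<n. \<Sum>t\<in>T i. g t (p i)) = (\<Sum>t\<in>PiE {0..<n} T. \<Prod>i = 0..<n. g (t i) (p i))" for p
    by (rule prod_sum_PiE) (use assms in auto)
  then show ?thesis
    by (simp add: Det_Leibniz sum_distrib_left sum.swap[of _ _ "PiE _ _"])
qed

text \<open>Left multiplication by a unitriangular bidiagonal matrix subtracts from each row the
  next one and leaves the last row as it is.\<close>

lemma Det_row_differences:
  "Det n f = Det n (\<lambda>i j. f i j - (if Suc i < n then f (Suc i) j else 0))"
proof -
  define B :: "nat \<Rightarrow> nat \<Rightarrow> 'a" where
    "B i k = (if k = i then 1 else 0) + (if k = Suc i then - 1 else 0)" for i k
  have B: "Det n B = 1"
    by (subst Det_upper_triangular) (auto simp: B_def)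
  have "Det n f = Det n B * Det n f" by (simp add: B)
  also have "\<dots> = Det n (\<lambda>i j. \<Sum>k<n. B i k * f k j)" by (rule Det_mult[symmetric])
  also have "\<dots> = Det n (\<lambda>i j. f i j - (if Suc i < n then f (Suc i) j else 0))"
    by (rule Det_cong)
      (auto simp: B_def distrib_right sum.distrib if_distrib[of "\<lambda>x. x * _"] sum.delta cong: if_cong)
  finally show ?thesis .
qed

text \<open>Subtracting from each row the previous one turns the constant first column into
  \<open>1, 0, 0, ...\<close>, so the size drops by one. Each elimination of a column by differences
  rests on this.\<close>

lemma Det_row_differences_Suc:
  fixes f :: "nat \<Rightarrow> nat \<Rightarrow> 'a::idom"
  assumes "\<And>i. i \<le> n \<Longrightarrow> f i 0 = 1"
  shows "Det (Suc n) f = Det n (\<lambda>i j. f (Suc i) (Suc j) - f i (Suc j))"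
proof -
  define B :: "nat \<Rightarrow> nat \<Rightarrow> 'a" where
    "B i k = (if k = i then 1 else 0) + (if Suc k = i then - 1 else 0)" for i k
  define g where "g i j = f i j - (if i = 0 then 0 else f (i - 1) j)" for i j
  have B: "Det (Suc n) B = 1"
    by (subst Det_lower_triangular) (auto simp: B_def)
  have "Det (Suc n) f = Det (Suc n) B * Det (Suc n) f" by (simp add: B)
  also have "\<dots> = Det (Suc n) (\<lambda>i j. \<Sum>k<Suc n. B i k * f k j)" by (rule Det_mult[symmetric])
  also have "\<dots> = Det (Suc n) g"
  proof (rule Det_cong)
    fix i j assume "i < Suc n"
    have "(\<Sum>k<Suc n. B i k * f k j) =
        (\<Sum>k<Suc n. if k = i then f k j else 0) + (\<Sum>k<Suc n. if Suc k = i then - f k j else 0)"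
      unfolding sum.distrib[symmetric] by (rule sum.cong) (auto simp: B_def)
    also have "(\<Sum>k<Suc n. if Suc k = i then - f k j else 0) = (if i = 0 then 0 else - f (i - 1) j)"
    proof (cases i)
      case (Suc i')
      have "(\<Sum>k<Suc n. if Suc k = i then - f k j else 0) = (\<Sum>k<Suc n. if k = i' then - f k j else 0)"
        by (rule sum.cong) (auto simp: Suc)
      also have "\<dots> = - f i' j" using \<open>i < Suc n\<close> Suc by (subst sum.delta) auto
      finally show ?thesis using Suc by simp
    qed auto
    also have "(\<Sum>k<Suc n. if k = i then f k j else 0) = f i j"
      using \<open>i < Suc n\<close> by (subst sum.delta) auto
    finally show "(\<Sum>k<Suc n. B i k * f k j) = g i j" by (simp add: g_def)
  qed
  \<comment> \<open>Transposed, that column is a first row with zeros right of the corner, the form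
    required by the block lemma.\<close>
  also have "\<dots> = Det (1 + n) (\<lambda>i j. g j i)" by (simp add: Det_transpose[of _ g])
  also have "\<dots> = Det 1 (\<lambda>i j. g j i) * Det n (\<lambda>i j. g (1 + j) (1 + i))"
    by (rule Det_block_lower_triangular) (use assms in \<open>auto simp: g_def\<close>)
  also have "Det 1 (\<lambda>i j. g j i) = 1"
    by (subst Det_lower_triangular) (use assms in \<open>auto simp: g_def\<close>)
  also have "Det n (\<lambda>i j. g (1 + j) (1 + i)) = Det n (\<lambda>i j. f (Suc i) (Suc j) - f i (Suc j))"
    by (subst Det_transpose) (simp add: g_def)
  finally show ?thesis by simp
qed

text \<open>A zero block whose height and width add up to more than \<open>n\<close> kills every Leibniz term.\<close>

lemma Det_zero_block:
  assumes "k < n" and zero: "\<And>i j. k \<le> i \<Longrightarrow> i < n \<Longrightarrow> j \<le> k \<Longrightarrow> f i j = 0"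
  shows "Det n f = 0"
proof -
  have "(\<Prod>i = 0..<n. f i (p i)) = 0" if p: "p permutes {0..<n}" for p
  proof (rule ccontr)
    assume nz: "(\<Prod>i = 0..<n. f i (p i)) \<noteq> 0"
    have "p i > k" if "k \<le> i" "i < n" for i
    proof (rule ccontr)
      assume "\<not> p i > k"
      then have "f i (p i) = 0" using zero that by simp
      then have "(\<Prod>i = 0..<n. f i (p i)) = 0"
        using that by (intro prod_zero) auto
      with nz show False by simp
    qed
    then have "p ` {k..<n} \<subseteq> {Suc k..<n}"
      using permutes_in_image[OF p] by (force simp: Suc_le_eq)
    then have "card (p ` {k..<n}) \<le> card {Suc k..<n}" by (intro card_mono) auto
    moreover have "card (p ` {k..<n}) = n - k"
      using permutes_inj[OF p] by (subst card_image) (auto simp: inj_on_def)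
    ultimately show False using \<open>k < n\<close> by simp
  qed
  then show ?thesis by (simp add: Det_Leibniz)
qed

section \<open>Change of polynomial basis and Vandermonde determinants\<close>

text \<open>Expanding each polynomial in powers factors the matrix as the one with pure powers times
  a coefficient matrix. The two column families carry different row weights \<open>v\<close> and
  \<open>w\<close> and do not mix, so the coefficient matrix is block diagonal.\<close>

lemma Det_polys:
  fixes x v w :: "nat \<Rightarrow> 'a::idom"
  assumes "\<And>j. j < A \<Longrightarrow> degree (P j) < A" and "\<And>j. j < B \<Longrightarrow> degree (G j) < B"
  shows "Det (A + B) (\<lambda>i j. if j < A then v i * poly (P j) (x i) else w i * poly (G (j - A)) (x i)) =
    Det (A + B) (\<lambda>i j. if j < A then v i * x i ^ j else w i * x i ^ (j - A)) *
    (Det A (\<lambda>k j. coeff (P j) k) * Det B (\<lambda>k j. coeff (G j) k))"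
proof -
  define C where "C k j = (if j < A \<and> k < A then coeff (P j) k
     else if A \<le> j \<and> A \<le> k then coeff (G (j - A)) (k - A) else 0)" for k j
  have poly_eq: "poly p y = (\<Sum>k<n. coeff p k * y ^ k)" if "degree p < n" for p :: "'a poly" and y n
    unfolding poly_altdef
    by (rule sum.mono_neutral_left) (use that in \<open>auto simp: coeff_eq_0\<close>)
  have "Det (A + B) C = Det A C * Det B (\<lambda>i j. C (A + i) (A + j))"
    by (rule Det_block_lower_triangular) (auto simp: C_def)
  also have "Det A C = Det A (\<lambda>k j. coeff (P j) k)"
    by (rule Det_cong) (auto simp: C_def)
  also have "Det B (\<lambda>i j. C (A + i) (A + j)) = Det B (\<lambda>k j. coeff (G j) k)"
    by (rule Det_cong) (auto simp: C_def)
  finally have C: "Det (A + B) C = Det A (\<lambda>k j. coeff (P j) k) * Det B (\<lambda>k j. coeff (G j) k)" .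
  show ?thesis unfolding C[symmetric] Det_mult[symmetric]
  proof (rule Det_cong)
    fix i j assume ij: "i < A + B" "j < A + B"
    have split: "(\<Sum>k<A + B. F k) = (\<Sum>k<A. F k) + (\<Sum>k<B. F (A + k))" for F :: "nat \<Rightarrow> 'a"
      using sum.atLeastLessThan_concat[of 0 A "A + B" F] sum.shift_bounds_nat_ivl[of F 0 A B]
      by (simp add: atLeast0LessThan add.commute)
    show "(if j < A then v i * poly (P j) (x i) else w i * poly (G (j - A)) (x i)) =
      (\<Sum>k<A + B. (if k < A then v i * x i ^ k else w i * x i ^ (k - A)) * C k j)"
    proof (cases "j < A")
      case True
      then show ?thesis
        by (simp add: split C_def poly_eq[OF assms(1)] sum_distrib_left algebra_simps)
    next
      case False
      then have "degree (G (j - A)) < B" using ij by (intro assms) auto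
      from poly_eq[OF this] show ?thesis using False
        by (simp add: split C_def sum_distrib_left algebra_simps)
    qed
  qed
qed

lemma Det_coeff_monic:
  fixes P :: "nat \<Rightarrow> 'a::comm_ring_1 poly"
  assumes "\<And>j. j < n \<Longrightarrow> degree (P j) = j" "\<And>j. j < n \<Longrightarrow> lead_coeff (P j) = 1"
  shows "Det n (\<lambda>k j. coeff (P j) k) = 1"
proof -
  have "Det n (\<lambda>k j. coeff (P j) k) = (\<Prod>i<n. coeff (P i) i)"
    by (rule Det_upper_triangular) (use assms in \<open>auto intro!: coeff_eq_0\<close>)
  also have "\<dots> = 1" using assms by (intro prod.neutral) auto
  finally show ?thesis .
qed

text \<open>Monic polynomials of degrees 0, 1, 2, ... have a unitriangular coefficient matrix, so
  this change of basis costs no factor.\<close>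

lemma Det_monic_polys:
  fixes x v w :: "nat \<Rightarrow> 'a::idom"
  assumes "\<And>j. j < A \<Longrightarrow> degree (P j) = j" "\<And>j. j < A \<Longrightarrow> lead_coeff (P j) = 1"
    and "\<And>j. j < B \<Longrightarrow> degree (G j) = j" "\<And>j. j < B \<Longrightarrow> lead_coeff (G j) = 1"
  shows "Det (A + B) (\<lambda>i j. if j < A then v i * poly (P j) (x i) else w i * poly (G (j - A)) (x i)) =
    Det (A + B) (\<lambda>i j. if j < A then v i * x i ^ j else w i * x i ^ (j - A))"
  by (subst Det_polys) (use assms in \<open>simp_all add: Det_coeff_monic\<close>)

abbreviation Vandermonde :: "nat \<Rightarrow> (nat \<Rightarrow> 'a) \<Rightarrow> 'a::comm_ring_1" where
  "Vandermonde n x \<equiv> Det n (\<lambda>i j. x i ^ j)"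

lemma Det_polys_Vandermonde:
  fixes x :: "nat \<Rightarrow> 'a::idom"
  assumes "\<And>j. j < n \<Longrightarrow> degree (P j) < n"
  shows "Det n (\<lambda>i j. poly (P j) (x i)) = Vandermonde n x * Det n (\<lambda>k j. coeff (P j) k)"
proof -
  have "Det n (\<lambda>i j. poly (P j) (x i)) = Det (n + 0) (\<lambda>i j. if j < n then 1 * poly (P j) (x i) else 1 * poly (P (j - n)) (x i))"
    by (simp, rule Det_cong) auto
  also have "\<dots> = Vandermonde n x * Det n (\<lambda>k j. coeff (P j) k)"
    by (subst Det_polys) (use assms in \<open>auto intro!: arg_cong2[where f = "(*)"] Det_cong simp: Det_Leibniz[of 0]\<close>)
  finally show ?thesis .
qed

definition root_poly :: "(nat \<Rightarrow> 'a) \<Rightarrow> nat \<Rightarrow> 'a::comm_ring_1 poly" where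
  "root_poly z n = (\<Prod>k<n. [:- z k, 1:])"

lemma poly_root_poly: "poly (root_poly z n) y = (\<Prod>k<n. y - z k)"
  by (simp add: root_poly_def poly_prod)

lemma monic_root_poly:
  fixes z :: "nat \<Rightarrow> 'a::idom"
  shows "degree (root_poly z n) = n" "lead_coeff (root_poly z n) = 1"
proof -
  show "degree (root_poly z n) = n"
    unfolding root_poly_def by (subst degree_prod_eq_sum_degree) auto
  show "lead_coeff (root_poly z n) = 1"
    unfolding root_poly_def lead_coeff_prod by simp
qed

lemma prod_lessThan_add:
  "(\<Prod>i<m + n. f i) = (\<Prod>i<m. f i) * (\<Prod>i<n. f (m + i))" for f :: "nat \<Rightarrow> 'a::comm_monoid_mult"
  by (induction n) (simp_all add: mult.assoc)

text \<open>The columns \<open>W x\<^sup>r\<close> and \<open>W Q x\<^sup>t\<close>, where \<open>W\<close> has the first \<open>r0\<close> points as roots,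
  span the same space and vanish in the first \<open>r0\<close> rows.\<close>

lemma Det_factorial_powers:
  fixes x z :: "nat \<Rightarrow> 'a::idom"
  assumes fact: "\<And>y. (\<Prod>t<r0 + c + b. y - z t) = (\<Prod>i<r0. y - x i) * Q y"
  shows "Det (r0 + c + a) (\<lambda>i j. \<Prod>t<(if j < r0 + c then j else j + b). x i - z t) =
    Vandermonde r0 x * (\<Prod>i<c + a. \<Prod>k<r0. x (r0 + i) - x k) *
    Det (c + a) (\<lambda>i j. if j < c then x (r0 + i) ^ j else Q (x (r0 + i)) * x (r0 + i) ^ (j - c))"
proof -
  let ?A = "r0 + c" and ?n = "r0 + c + b"
  let ?w = "\<lambda>i. \<Prod>t<?n. x i - z t"
  let ?W = "\<lambda>i. \<Prod>k<r0. x (r0 + i) - x k"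
  \<comment> \<open>\<open>P\<close> is a monic basis of the polynomials of degree below
    \<open>r0 + c\<close> whose members from index \<open>r0\<close> on vanish at the first
    \<open>r0\<close> points.\<close>
  define P where "P j = (if j < r0 then monom 1 j else root_poly x r0 * monom 1 (j - r0))" for j
  define f where
    "f i j = (if j < ?A then 1 * poly (P j) (x i) else ?w i * poly (monom 1 (j - ?A)) (x i))" for i j
  have "Det (?A + a) (\<lambda>i j. \<Prod>t<(if j < ?A then j else j + b). x i - z t) =
    Det (?A + a) (\<lambda>i j. if j < ?A then 1 * poly (root_poly z j) (x i)
       else ?w i * poly (root_poly (\<lambda>s. z (?n + s)) (j - ?A)) (x i))"
  proof (rule Det_cong)
    fix i j
    show "(\<Prod>t<(if j < ?A then j else j + b). x i - z t) = (if j < ?A then 1 * poly (root_poly z j) (x i)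
       else ?w i * poly (root_poly (\<lambda>s. z (?n + s)) (j - ?A)) (x i))"
    proof (cases "j < ?A")
      case False
      \<comment> \<open>The late columns all contain the first \<open>?n\<close> factors; what
        remains is monic of degree \<open>j - ?A\<close>.\<close>
      then have "j + b = ?n + (j - ?A)" by simp
      then have "(\<Prod>t<j + b. x i - z t) = ?w i * (\<Prod>t<j - ?A. x i - z (?n + t))"
        by (simp only: prod_lessThan_add[of _ ?n])
      then show ?thesis using False by (simp add: poly_root_poly)
    qed (simp add: poly_root_poly)
  qed
  also have "\<dots> = Det (?A + a) (\<lambda>i j. if j < ?A then 1 * x i ^ j else ?w i * x i ^ (j - ?A))"
    by (intro Det_monic_polys monic_root_poly)
  also have "\<dots> = Det (?A + a) f"
    unfolding f_def
  proof (rule Det_monic_polys[symmetric])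
    fix j assume "j < ?A"
    have nz: "root_poly x r0 \<noteq> 0" using monic_root_poly(2)[of x r0] by auto
    show "degree (P j) = j"
      unfolding P_def using nz by (auto simp: degree_monom_eq degree_mult_eq monic_root_poly(1))
    show "lead_coeff (P j) = 1"
      by (cases "j < r0") (simp_all add: P_def degree_monom_eq lead_coeff_mult monic_root_poly(2))
  qed (auto simp: degree_monom_eq)
  also have "\<dots> = Det (r0 + (c + a)) f" by (simp add: add.assoc)
  also have "\<dots> = Det r0 f * Det (c + a) (\<lambda>i j. f (r0 + i) (r0 + j))"
  proof (rule Det_block_lower_triangular)
    fix i j assume ij: "i < r0" "r0 \<le> j"
    \<comment> \<open>This also kills the late columns, because \<open>fact\<close> gives the weight
      \<open>?w\<close> these same linear factors.\<close>
    then have "(\<Prod>k<r0. x i - x k) = 0" by (intro prod_zero) auto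
    then show "f i j = 0" using ij by (simp add: f_def P_def poly_root_poly fact)
  qed
  also have "Det r0 f = Vandermonde r0 x"
    by (rule Det_cong) (simp add: f_def P_def poly_monom)
  also have "Det (c + a) (\<lambda>i j. f (r0 + i) (r0 + j)) = Det (c + a) (\<lambda>i j. ?W i * 1 *
      (if j < c then x (r0 + i) ^ j else Q (x (r0 + i)) * x (r0 + i) ^ (j - c)))"
    by (rule Det_cong) (auto simp: f_def P_def poly_root_poly fact poly_monom)
  finally show ?thesis
    unfolding Det_scale by simp
qed

text \<open>In the Newton basis the matrix is lower triangular, since \<open>root_poly x j\<close>
  vanishes at \<open>x i\<close> for \<open>i < j\<close>.\<close>

lemma Vandermonde_eq:
  fixes x :: "nat \<Rightarrow> 'a::idom"
  shows "Vandermonde n x = (\<Prod>i<n. \<Prod>k<i. x i - x k)"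
proof -
  have "Vandermonde n x = Det n (\<lambda>i j. poly (root_poly x j) (x i))"
    by (subst Det_polys_Vandermonde, simp add: monic_root_poly)
      (subst Det_coeff_monic, rule monic_root_poly, rule monic_root_poly, simp)
  also have "\<dots> = (\<Prod>i<n. \<Prod>k<i. x i - x k)"
    by (subst Det_lower_triangular) (auto simp: poly_root_poly intro!: prod_zero)
  finally show ?thesis .
qed

section \<open>The Jacobi-Trudi determinant\<close>

text \<open>With \<open>q\<close> invertible and no root of unity, every \<open>1 - q ^ k\<close>
  with \<open>k > 0\<close> is a legitimate denominator. The instance of interest is the variable of
  rational Laurent series.\<close>

locale qfield =
  fixes q :: "'a::field"
  assumes q_nonzero: "q \<noteq> 0" and q_power_neq_1: "k > 0 \<Longrightarrow> q ^ k \<noteq> 1"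
begin

definition qfact :: "nat \<Rightarrow> 'a" where
  "qfact n = (\<Prod>k = 1..n. 1 - q ^ k)"

text \<open>\<open>h l k\<close> is the complete homogeneous \<open>h\<^bsub>l-k\<^esub>(1, q, q\<^sup>2, \<dots>)\<close>. In \<open>jacobi_trudi\<close> the rows of the
  partitions are numbered from the bottom, so that \<open>l j = lam (R - j) + j\<close> and
  \<open>k j = mu (R - j) + j\<close> increase with \<open>j\<close>.\<close>

definition h :: "nat \<Rightarrow> nat \<Rightarrow> 'a" where
  "h l k = (if k \<le> l then 1 / qfact (l - k) else 0)"

definition jacobi_trudi :: "nat \<Rightarrow> (nat \<Rightarrow> nat) \<Rightarrow> (nat \<Rightarrow> nat) \<Rightarrow> 'a" where
  "jacobi_trudi R l k = Det R (\<lambda>j i. h (l i) (k j))"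

text \<open>In shifted coordinates these are the \<open>nu\<close> inside \<open>lam\<close> with
  \<open>nu/mu\<close> a horizontal strip: \<open>t j < k (Suc j)\<close> says that a part of
  \<open>nu\<close> is at most the part of \<open>mu\<close> one row higher.\<close>

definition interlacing :: "nat \<Rightarrow> (nat \<Rightarrow> nat) \<Rightarrow> (nat \<Rightarrow> nat) \<Rightarrow> (nat \<Rightarrow> nat) set" where
  "interlacing R l k = {t \<in> extensional {0..<R}. \<forall>j<R. k j \<le> t j \<and> t j \<le> l j \<and> (Suc j < R \<longrightarrow> t j < k (Suc j))}"

lemma qfact_nonzero: "qfact n \<noteq> 0"
  using q_power_neq_1 by (auto simp: qfact_def)

lemma qfact_Suc: "qfact (Suc n) = qfact n * (1 - q ^ Suc n)"
  by (simp add: qfact_def)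

text \<open>For \<open>k < l\<close> this is \<open>1/(q;q)_n - 1/(q;q)_(n-1) = q^n/(q;q)_n\<close>
  with \<open>n = l - k\<close>. At \<open>k = l\<close> it holds because \<open>h\<close> is zero
  beyond \<open>l\<close>.\<close>

lemma h_diff: "h l k - h l (Suc k) = q ^ l / q ^ k * h l k"
proof (cases "k < l")
  case True
  then obtain n where n: "l - k = Suc n" "l = k + Suc n"
    by (metis less_imp_Suc_add add_Suc_right add_diff_cancel_left')
  have "1 - q ^ Suc n \<noteq> 0" using q_power_neq_1[of "Suc n"] by simp
  then have "1 / qfact (Suc n) - 1 / qfact n = q ^ Suc n * (1 / qfact (Suc n))"
    unfolding qfact_Suc using qfact_nonzero[of n] by (simp add: divide_simps)
  moreover have "q ^ l / q ^ k = q ^ Suc n" using q_nonzero n(2) by (simp add: power_add)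
  moreover have "l - Suc k = n" using n by simp
  ultimately show ?thesis using True n(1) by (simp only: h_def) simp
next
  case False
  then show ?thesis using q_nonzero by (cases "k = l") (auto simp: h_def qfact_def)
qed

lemma h_telescope:
  assumes "k \<le> k'"
  shows "(\<Sum>t = k..<k'. q ^ l / q ^ t * h l t) = h l k - h l k'"
  unfolding h_diff[symmetric]
  using assms by (induction k' rule: dec_induct) simp_all

text \<open>If \<open>l j < t j\<close>, monotonicity makes all entries with first index at least
  \<open>j\<close> and second index at most \<open>j\<close> zero, too large a zero block.\<close>

lemma jacobi_trudi_zero:
  assumes "j < R" "l j < t j"
    and "\<And>i. i \<le> j \<Longrightarrow> l i \<le> l j" and "\<And>i. j \<le> i \<Longrightarrow> i < R \<Longrightarrow> t j \<le> t i"
  shows "jacobi_trudi R l t = 0"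
  unfolding jacobi_trudi_def
proof (rule Det_zero_block[OF assms(1)])
  fix i i' assume "j \<le> i" "i < R" "i' \<le> j"
  with assms have "l i' < t i" by (meson le_less_trans less_le_trans)
  then show "h (l i') (t i) = 0" by (simp add: h_def)
qed

lemma mono_nat_below:
  fixes f :: "nat \<Rightarrow> nat"
  assumes "\<And>j. Suc j < R \<Longrightarrow> f j < f (Suc j)" and "i \<le> j" "j < R"
  shows "f i \<le> f j"
  using assms(2,3) by (induction j rule: dec_induct) (use assms(1) in \<open>force simp: less_imp_le\<close>)+

lemma jacobi_trudi_recurrence:
  assumes l: "\<And>j. Suc j < R \<Longrightarrow> l j < l (Suc j)"
    and k: "\<And>j. Suc j < R \<Longrightarrow> k j < k (Suc j)" and kl: "\<And>j. j < R \<Longrightarrow> k j \<le> l j"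
  shows "jacobi_trudi R l k = (\<Sum>t\<in>interlacing R l k. q ^ (\<Sum>j<R. l j - t j) * jacobi_trudi R l t)"
proof -
  \<comment> \<open>The last row is left undifferenced, but \<open>h (l i) (Suc (l j))\<close> is
    zero there, so stopping at \<open>Suc (l j)\<close> gives it the same telescoping form.\<close>
  define k' where "k' j = (if Suc j < R then k (Suc j) else Suc (l j))" for j
  have kk': "k j \<le> k' j" if "j < R" for j
    using k kl that by (auto simp: k'_def le_Suc_eq less_imp_le)
  have *: "h (l i) (k j) - (if Suc j < R then h (l i) (k (Suc j)) else 0) =
      (\<Sum>t = k j..<k' j. q ^ l i / q ^ t * h (l i) t)" if "i < R" "j < R" for i j
  proof (cases "Suc j < R")
    case True
    then show ?thesis using h_telescope[OF kk'[OF that(2)]] by (simp add: k'_def)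
  next
    case False
    then have "l i \<le> l j" using that mono_nat_below[of R l i j] l by simp
    then show ?thesis using False h_telescope[OF kk'[OF that(2)], of "l i"] by (simp add: k'_def h_def)
  qed
  let ?P = "PiE {0..<R} (\<lambda>j. {k j..<k' j})"
  have fin: "finite ?P" by (intro finite_PiE) auto
  have sub: "interlacing R l k \<subseteq> ?P"
    by (auto simp: interlacing_def PiE_def k'_def Pi_def le_imp_less_Suc)
  have "jacobi_trudi R l k = Det R (\<lambda>j i. \<Sum>t = k j..<k' j. q ^ l i / q ^ t * h (l i) t)"
    unfolding jacobi_trudi_def by (subst Det_row_differences, rule Det_cong) (rule *)
  also have "\<dots> = (\<Sum>t\<in>?P. Det R (\<lambda>j i. q ^ l i / q ^ t j * h (l i) (t j)))"
    by (rule Det_row_sums) auto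
  also have "\<dots> = (\<Sum>t\<in>?P. (\<Prod>j<R. 1 / q ^ t j) * (\<Prod>i<R. q ^ l i) * jacobi_trudi R l t)"
    unfolding jacobi_trudi_def Det_scale[symmetric] by simp
  also have "\<dots> = (\<Sum>t\<in>interlacing R l k. (\<Prod>j<R. 1 / q ^ t j) * (\<Prod>i<R. q ^ l i) * jacobi_trudi R l t)"
  \<comment> \<open>A choice violating interlacing must have \<open>t j > l j\<close> for some
    \<open>j\<close>, the other bounds being built into \<open>?P\<close>; its determinant is
    zero.\<close>
  proof (rule sum.mono_neutral_right[OF fin sub], rule ballI)
    fix t assume t: "t \<in> ?P - interlacing R l k"
    have tP: "k j \<le> t j" "t j < k' j" if "j < R" for j using t that by (auto simp: PiE_iff)
    have tS: "Suc j < R \<Longrightarrow> t j < k (Suc j)" for j using tP[of j] by (simp add: k'_def)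
    obtain j where j: "j < R" "l j < t j"
      using t tP tS by (force simp: interlacing_def PiE_def not_le)
    have "jacobi_trudi R l t = 0"
    proof (rule jacobi_trudi_zero[of j R l t, OF j])
      show "l i \<le> l j" if "i \<le> j" for i using mono_nat_below[of R l i j] l that j by simp
      show "t j \<le> t i" if "j \<le> i" "i < R" for i
        using mono_nat_below[of R t j i] tS tP that less_le_trans by blast
    qed
    then show "(\<Prod>j<R. 1 / q ^ t j) * (\<Prod>i<R. q ^ l i) * jacobi_trudi R l t = 0" by simp
  qed
  also have "\<dots> = (\<Sum>t\<in>interlacing R l k. q ^ (\<Sum>j<R. l j - t j) * jacobi_trudi R l t)"
  proof (rule sum.cong[OF refl])
    fix t assume t: "t \<in> interlacing R l k"
    have "(\<Prod>j<R. 1 / q ^ t j) * (\<Prod>i<R. q ^ l i) = (\<Prod>j<R. q ^ (l j - t j))"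
      unfolding prod.distrib[symmetric]
      by (rule prod.cong) (use t q_nonzero in \<open>auto simp: interlacing_def power_diff\<close>)
    then show "(\<Prod>j<R. 1 / q ^ t j) * (\<Prod>i<R. q ^ l i) * jacobi_trudi R l t =
        q ^ (\<Sum>j<R. l j - t j) * jacobi_trudi R l t"
      by (simp add: power_sum)
  qed
  finally show ?thesis .
qed

lemma jacobi_trudi_self:
  assumes l: "\<And>j. Suc j < R \<Longrightarrow> l j < l (Suc j)" and kl: "\<And>j. j < R \<Longrightarrow> k j = l j"
  shows "jacobi_trudi R l k = 1"
proof -
  have less: "l i < l j" if "i < j" "j < R" for i j
    using l[of i] mono_nat_below[of R l "Suc i" j] l that by fastforce
  have "jacobi_trudi R l k = (\<Prod>i<R. h (l i) (k i))"
    unfolding jacobi_trudi_def by (subst Det_upper_triangular) (auto simp: kl h_def dest: less)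
  also have "\<dots> = 1" by (rule prod.neutral) (auto simp: kl h_def qfact_def)
  finally show ?thesis .
qed

text \<open>Since \<open>k\<close> itself interlaces, \<open>S k\<close> occurs on both sides of the
  recurrence, on the right with coefficient \<open>q ^ w\<close>, where \<open>w\<close> is the
  total gap between \<open>k\<close> and \<open>l\<close>. For \<open>w > 0\<close> dividing by
  \<open>1 - q ^ w\<close> expresses \<open>S k\<close> through sequences strictly closer to
  \<open>l\<close>; for \<open>w = 0\<close> the base case applies.\<close>

lemma jacobi_trudi_unique:
  fixes S :: "(nat \<Rightarrow> nat) \<Rightarrow> 'a"
  assumes l: "\<And>j. Suc j < R \<Longrightarrow> l j < l (Suc j)"
    and base: "\<And>k. (\<And>j. j < R \<Longrightarrow> k j = l j) \<Longrightarrow> S k = 1"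
    and rec: "\<And>k. (\<And>j. Suc j < R \<Longrightarrow> k j < k (Suc j)) \<Longrightarrow> (\<And>j. j < R \<Longrightarrow> k j \<le> l j) \<Longrightarrow>
       S k = (\<Sum>t\<in>interlacing R l k. q ^ (\<Sum>j<R. l j - t j) * S t)"
    and "\<And>j. Suc j < R \<Longrightarrow> k j < k (Suc j)" "\<And>j. j < R \<Longrightarrow> k j \<le> l j" "k \<in> extensional {0..<R}"
  shows "S k = jacobi_trudi R l k"
  using assms(4-)
proof (induction "\<Sum>j<R. l j - k j" arbitrary: k rule: less_induct)
  case less
  note k = less.prems
  let ?w = "\<Sum>j<R. l j - k j"
  show ?case
  proof (cases "?w = 0")
    case True
    then have "k j = l j" if "j < R" for j using k(2)[of j] that by (auto intro!: antisym)
    then show ?thesis using base[of k] jacobi_trudi_self[of R l k] l by simp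
  next
    case False
    let ?F = "interlacing R l k"
    have "?F \<subseteq> PiE {0..<R} (\<lambda>j. {..l j})" by (auto simp: interlacing_def PiE_def)
    then have fin: "finite ?F" by (rule finite_subset) (auto intro: finite_PiE)
    have kF: "k \<in> ?F" using k by (auto simp: interlacing_def)
    have IH: "S t = jacobi_trudi R l t" if t: "t \<in> ?F - {k}" for t
    proof (rule less.hyps)
      have "\<exists>j<R. k j \<noteq> t j"
        using t k(3) by (auto simp: interlacing_def extensional_def fun_eq_iff) (metis not_less)+
      then show "(\<Sum>j<R. l j - t j) < ?w"
        using t by (intro sum_strict_mono_ex1) (force simp: interlacing_def)+
      show "t j < t (Suc j)" if "Suc j < R" for j
        using t that by (force simp: interlacing_def intro: less_le_trans[of _ "k (Suc j)"])
    qed (use t in \<open>auto simp: interlacing_def\<close>)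
    have "S k = (\<Sum>t\<in>?F. q ^ (\<Sum>j<R. l j - t j) * S t)" using k by (intro rec)
    also have "\<dots> = q ^ ?w * S k + (\<Sum>t\<in>?F - {k}. q ^ (\<Sum>j<R. l j - t j) * S t)"
      by (rule sum.remove[OF fin kF])
    finally have 1: "S k = q ^ ?w * S k + (\<Sum>t\<in>?F - {k}. q ^ (\<Sum>j<R. l j - t j) * S t)" .
    have "jacobi_trudi R l k = (\<Sum>t\<in>?F. q ^ (\<Sum>j<R. l j - t j) * jacobi_trudi R l t)"
      using l k by (intro jacobi_trudi_recurrence)
    then have 2: "jacobi_trudi R l k = q ^ ?w * jacobi_trudi R l k +
        (\<Sum>t\<in>?F - {k}. q ^ (\<Sum>j<R. l j - t j) * jacobi_trudi R l t)"
      by (rule trans[OF _ sum.remove[OF fin kF]])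
    have 3: "(\<Sum>t\<in>?F - {k}. q ^ (\<Sum>j<R. l j - t j) * S t) =
        (\<Sum>t\<in>?F - {k}. q ^ (\<Sum>j<R. l j - t j) * jacobi_trudi R l t)"
      using IH by (intro sum.cong) auto
    have "S k - q ^ ?w * S k = (\<Sum>t\<in>?F - {k}. q ^ (\<Sum>j<R. l j - t j) * S t)"
      unfolding diff_eq_eq by (rule trans[OF 1 add.commute])
    also have "\<dots> = jacobi_trudi R l k - q ^ ?w * jacobi_trudi R l k"
      unfolding eq_diff_eq 3 by (rule trans[OF add.commute 2[symmetric]])
    finally have "S k - q ^ ?w * S k = jacobi_trudi R l k - q ^ ?w * jacobi_trudi R l k" .
    then have "(1 - q ^ ?w) * S k = (1 - q ^ ?w) * jacobi_trudi R l k"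
      by (simp add: left_diff_distrib)
    moreover have "q ^ ?w \<noteq> 1" using False by (intro q_power_neq_1) (simp only: neq0_conv)
    ultimately show ?thesis by simp
  qed
qed

end

section \<open>Semistandard tableaux\<close>

definition row_skew :: "nat \<Rightarrow> (nat \<Rightarrow> nat) \<Rightarrow> (nat \<Rightarrow> nat) \<Rightarrow> (nat \<times> nat) set" where
  "row_skew R lam mu = (SIGMA i:{1..R}. {mu i<..lam i})"

text \<open>The value of the infinite sum over tableaux, given by its coefficients, so that peeling
  becomes a matter of counting finite sets.\<close>

definition SSYT_gf :: "(nat \<times> nat) set \<Rightarrow> rat fps" where
  "SSYT_gf S = Abs_fps (\<lambda>n. of_nat (card {T \<in> SSYT S. (\<Sum>u\<in>S. T u - 1) = n}))"

text \<open>Extensionality makes the set finite and the representation of each strip unique.\<close>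

definition horizontal_strips :: "nat \<Rightarrow> (nat \<Rightarrow> nat) \<Rightarrow> (nat \<Rightarrow> nat) \<Rightarrow> (nat \<Rightarrow> nat) set" where
  "horizontal_strips R lam mu =
     {nu \<in> extensional {1..R}. \<forall>i\<in>{1..R}. mu i \<le> nu i \<and> nu i \<le> lam i \<and> (Suc i \<le> R \<longrightarrow> nu (Suc i) \<le> mu i)}"

lemma SSYT_D:
  assumes "T \<in> SSYT S"
  shows "u \<in> S \<Longrightarrow> 1 \<le> T u"
    and "(i, j) \<in> S \<Longrightarrow> (i, j') \<in> S \<Longrightarrow> j < j' \<Longrightarrow> T (i, j) \<le> T (i, j')"
    and "(i, j) \<in> S \<Longrightarrow> (i', j) \<in> S \<Longrightarrow> i < i' \<Longrightarrow> T (i, j) < T (i', j)"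
    and "T \<in> extensional S"
  using assms unfolding SSYT_def PiE_iff by auto

lemma SSYT_I:
  assumes "\<And>u. u \<in> S \<Longrightarrow> 1 \<le> T u"
    and "\<And>i j j'. (i, j) \<in> S \<Longrightarrow> (i, j') \<in> S \<Longrightarrow> j < j' \<Longrightarrow> T (i, j) \<le> T (i, j')"
    and "\<And>i j i'. (i, j) \<in> S \<Longrightarrow> (i', j) \<in> S \<Longrightarrow> i < i' \<Longrightarrow> T (i, j) < T (i', j)"
    and "T \<in> extensional S"
  shows "T \<in> SSYT S"
  using assms unfolding SSYT_def PiE_iff by auto

lemma mem_row_skew: "(i, j) \<in> row_skew R lam mu \<longleftrightarrow> i \<in> {1..R} \<and> mu i < j \<and> j \<le> lam i"
  by (auto simp: row_skew_def)

lemma finite_row_skew: "finite (row_skew R lam mu)"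
  by (simp add: row_skew_def)

lemma card_row_skew: "card (row_skew R lam mu) = (\<Sum>i = 1..R. lam i - mu i)"
  by (simp add: row_skew_def)

section \<open>Removing the entries 1 from a tableau\<close>

text \<open>Inverse of the peeling step, which deletes all entries \<open>1\<close> and lowers the
  rest.\<close>

definition restore_ones ::
  "(nat \<times> nat) set \<Rightarrow> (nat \<times> nat) set \<Rightarrow> (nat \<times> nat \<Rightarrow> nat) \<Rightarrow> nat \<times> nat \<Rightarrow> nat" where
  "restore_ones S U T = (\<lambda>u\<in>S. if u \<in> U then T u + 1 else 1)"

context
  fixes R :: nat and lam mu :: "nat \<Rightarrow> nat"
  assumes lam: "\<And>i j. 1 \<le> i \<Longrightarrow> i \<le> j \<Longrightarrow> j \<le> R \<Longrightarrow> lam j \<le> lam i"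
    and mu: "\<And>i j. 1 \<le> i \<Longrightarrow> i \<le> j \<Longrightarrow> j \<le> R \<Longrightarrow> mu j \<le> mu i"
    and mu_lam: "\<And>i. i \<in> {1..R} \<Longrightarrow> mu i \<le> lam i"
begin

lemma horizontal_strip_below:
  assumes "nu \<in> horizontal_strips R lam mu" "1 \<le> i" "i < i'" "i' \<le> R"
  shows "nu i' \<le> mu i"
proof -
  obtain n where n: "i' = Suc n" "i \<le> n" using assms by (cases i') auto
  have "nu i' \<le> mu n" using assms n by (auto simp: horizontal_strips_def)
  also have "mu n \<le> mu i" using mu assms n by simp
  finally show ?thesis .
qed

lemma row_skew_mono:
  assumes "nu \<in> horizontal_strips R lam mu"
  shows "row_skew R lam nu \<subseteq> row_skew R lam mu"
  using assms by (force simp: mem_row_skew horizontal_strips_def)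

text \<open>Along a row the cells refilled with \<open>1\<close> come first. Down a column the strip
  condition puts the lower of any two cells into \<open>lam/nu\<close>, whose raised entries are at
  least \<open>2\<close>.\<close>

lemma restore_ones_SSYT:
  assumes nu: "nu \<in> horizontal_strips R lam mu" and T: "T \<in> SSYT (row_skew R lam nu)"
  shows "restore_ones (row_skew R lam mu) (row_skew R lam nu) T \<in> SSYT (row_skew R lam mu)"
proof -
  let ?S = "row_skew R lam mu" and ?U = "row_skew R lam nu"
  let ?T = "restore_ones ?S ?U T"
  note ge = SSYT_D(1)[OF T] and row = SSYT_D(2)[OF T] and col = SSYT_D(3)[OF T]
  have "?T (i, j) \<le> ?T (i, j')" if "(i, j) \<in> ?S" "(i, j') \<in> ?S" "j < j'" for i j j'
  proof (cases "(i, j) \<in> ?U")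
    case True
    then have "(i, j') \<in> ?U" using that by (auto simp: mem_row_skew)
    then show ?thesis using True that row by (simp add: restore_ones_def)
  qed (use that in \<open>auto simp: restore_ones_def\<close>)
  moreover have "?T (i, j) < ?T (i', j)" if "(i, j) \<in> ?S" "(i', j) \<in> ?S" "i < i'" for i i' j
  proof -
    have "nu i' \<le> mu i" using horizontal_strip_below[OF nu] that by (auto simp: mem_row_skew)
    then have "(i', j) \<in> ?U" using that by (auto simp: mem_row_skew)
    then show ?thesis using that col ge[of "(i', j)"] by (auto simp: restore_ones_def)
  qed
  ultimately show ?thesis by (intro SSYT_I) (auto simp: restore_ones_def)
qed

lemma weight_restore_ones:
  assumes nu: "nu \<in> horizontal_strips R lam mu" and T: "T \<in> SSYT (row_skew R lam nu)"
  shows "(\<Sum>u\<in>row_skew R lam mu. restore_ones (row_skew R lam mu) (row_skew R lam nu) T u - 1) =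
    (\<Sum>u\<in>row_skew R lam nu. T u - 1) + card (row_skew R lam nu)"
proof -
  let ?S = "row_skew R lam mu" and ?U = "row_skew R lam nu"
  have sub: "?U \<subseteq> ?S" by (rule row_skew_mono[OF nu])
  note ge = SSYT_D(1)[OF T]
  have "(\<Sum>u\<in>?S. restore_ones ?S ?U T u - 1) = (\<Sum>u\<in>?U. restore_ones ?S ?U T u - 1)"
    by (rule sum.mono_neutral_right) (use sub in \<open>auto simp: finite_row_skew restore_ones_def\<close>)
  also have "\<dots> = (\<Sum>u\<in>?U. (T u - 1) + 1)"
    by (rule sum.cong) (use sub ge in \<open>force simp: restore_ones_def\<close>)+
  finally show ?thesis by (simp only: sum.distrib) simp
qed

text \<open>Inserting \<open>mu i\<close> gives the value for rows without an entry
  \<open>1\<close>.\<close>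

definition ones_strip :: "(nat \<times> nat \<Rightarrow> nat) \<Rightarrow> nat \<Rightarrow> nat" where
  "ones_strip T = (\<lambda>i\<in>{1..R}. Max (insert (mu i) {j. (i, j) \<in> row_skew R lam mu \<and> T (i, j) = 1}))"

text \<open>Entries are positive and rows increase weakly, so the ones of a row form an initial
  segment.\<close>

lemma ones_strip_iff:
  assumes T: "T \<in> SSYT (row_skew R lam mu)" and ij: "(i, j) \<in> row_skew R lam mu"
  shows "j \<le> ones_strip T i \<longleftrightarrow> T (i, j) = 1"
proof -
  let ?J = "{j. (i, j) \<in> row_skew R lam mu \<and> T (i, j) = 1}"
  have i: "i \<in> {1..R}" and j: "mu i < j" using ij by (auto simp: mem_row_skew)
  have fin: "finite ?J" by (rule finite_subset[of _ "{..lam i}"]) (auto simp: mem_row_skew)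
  have e: "ones_strip T i = Max (insert (mu i) ?J)" using i by (simp add: ones_strip_def)
  show ?thesis
  proof
    assume "j \<le> ones_strip T i"
    moreover from this have "ones_strip T i \<in> ?J"
      using Max_in[of "insert (mu i) ?J"] fin j unfolding e by auto
    ultimately have "T (i, j) \<le> 1"
      using SSYT_D(2)[OF T, of i j "ones_strip T i"] ij by (cases "j = ones_strip T i") auto
    moreover have "T (i, j) \<ge> 1" using SSYT_D(1)[OF T ij] .
    ultimately show "T (i, j) = 1" by simp
  next
    assume "T (i, j) = 1"
    then show "j \<le> ones_strip T i" unfolding e using fin ij by (intro Max_ge) auto
  qed
qed

lemma ones_strip_bounds:
  assumes "i \<in> {1..R}"
  shows "mu i \<le> ones_strip T i" "ones_strip T i \<le> lam i"
proof -
  let ?J = "{j. (i, j) \<in> row_skew R lam mu \<and> T (i, j) = 1}"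
  have fin: "finite ?J" by (rule finite_subset[of _ "{..lam i}"]) (auto simp: mem_row_skew)
  have e: "ones_strip T i = Max (insert (mu i) ?J)" using assms by (simp add: ones_strip_def)
  show "mu i \<le> ones_strip T i" unfolding e using fin by (intro Max_ge) auto
  show "ones_strip T i \<le> lam i" unfolding e using fin mu_lam[OF assms]
    by (intro Max.boundedI) (auto simp: mem_row_skew)
qed

text \<open>Otherwise some \<open>1\<close> of row \<open>Suc i\<close> would have a cell of the
  shape directly above it, forcing a positive entry below \<open>1\<close>.\<close>

lemma ones_strip_horizontal:
  assumes T: "T \<in> SSYT (row_skew R lam mu)"
  shows "ones_strip T \<in> horizontal_strips R lam mu"
proof -
  have "ones_strip T (Suc i) \<le> mu i" if i: "i \<in> {1..R}" "Suc i \<le> R" for i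
  proof (rule ccontr)
    let ?j = "ones_strip T (Suc i)"
    assume "\<not> ?j \<le> mu i"
    then have "(i, ?j) \<in> row_skew R lam mu" "(Suc i, ?j) \<in> row_skew R lam mu"
      using i ones_strip_bounds(2)[of "Suc i" T] lam[of i "Suc i"] mu[of i "Suc i"]
      by (auto simp: mem_row_skew)
    moreover from this have "T (Suc i, ?j) = 1" using ones_strip_iff[OF T] by blast
    moreover have "T (i, ?j) \<ge> 1" by (rule SSYT_D(1)[OF T calculation(1)])
    moreover have "T (i, ?j) < T (Suc i, ?j)"
      by (rule SSYT_D(3)[OF T calculation(1,2)]) simp
    ultimately show False by simp
  qed
  then show ?thesis
    using ones_strip_bounds by (auto simp: horizontal_strips_def) (simp add: ones_strip_def)
qed

lemma mem_ones_strip_row_skew: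
  assumes T: "T \<in> SSYT (row_skew R lam mu)"
  shows "u \<in> row_skew R lam (ones_strip T) \<longleftrightarrow> u \<in> row_skew R lam mu \<and> T u \<noteq> 1"
proof -
  obtain i j where u: "u = (i, j)" by (cases u)
  show ?thesis
  proof (cases "u \<in> row_skew R lam mu")
    case True
    then show ?thesis using ones_strip_iff[OF T, of i j] u by (simp add: mem_row_skew) (metis not_less)
  next
    case False
    then show ?thesis using row_skew_mono[OF ones_strip_horizontal[OF T]] by blast
  qed
qed

lemma remove_ones_SSYT:
  assumes T: "T \<in> SSYT (row_skew R lam mu)"
  shows "(\<lambda>u\<in>row_skew R lam (ones_strip T). T u - 1) \<in> SSYT (row_skew R lam (ones_strip T))"
proof -
  let ?S = "row_skew R lam mu" and ?U = "row_skew R lam (ones_strip T)"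
  have U: "u \<in> ?S" "T u \<ge> 2" if "u \<in> ?U" for u
  proof -
    have "u \<in> ?S" "T u \<noteq> 1" using that mem_ones_strip_row_skew[OF T] by auto
    then show "u \<in> ?S" "T u \<ge> 2" using SSYT_D(1)[OF T, of u] by auto
  qed
  show ?thesis
  proof (rule SSYT_I)
    show "1 \<le> (\<lambda>u\<in>?U. T u - 1) u" if "u \<in> ?U" for u using U(2)[OF that] that by simp
    show "(\<lambda>u\<in>?U. T u - 1) (i, j) \<le> (\<lambda>u\<in>?U. T u - 1) (i, j')"
      if "(i, j) \<in> ?U" "(i, j') \<in> ?U" "j < j'" for i j j'
      using SSYT_D(2)[OF T U(1)[OF that(1)] U(1)[OF that(2)] that(3)] that by (simp add: diff_le_mono)
    show "(\<lambda>u\<in>?U. T u - 1) (i, j) < (\<lambda>u\<in>?U. T u - 1) (i', j)"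
      if "(i, j) \<in> ?U" "(i', j) \<in> ?U" "i < i'" for i i' j
      using SSYT_D(3)[OF T U(1)[OF that(1)] U(1)[OF that(2)] that(3)] U(2)[OF that(1)] that by simp
  qed simp
qed

text \<open>A tableau corresponds to the pair of the strip of its ones and the remaining tableau
  with lowered entries; lowering loses one unit of weight per cell of \<open>lam/nu\<close>.\<close>

lemma card_SSYT_weight_peel:
  "card {T \<in> SSYT (row_skew R lam mu). (\<Sum>u\<in>row_skew R lam mu. T u - 1) = n} =
    (\<Sum>nu\<in>horizontal_strips R lam mu. card {T \<in> SSYT (row_skew R lam nu).
       (\<Sum>u\<in>row_skew R lam nu. T u - 1) + card (row_skew R lam nu) = n})"
proof -
  let ?S = "row_skew R lam mu" and ?U = "\<lambda>nu. row_skew R lam nu"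
  let ?H = "horizontal_strips R lam mu"
  let ?A = "\<lambda>nu. {T \<in> SSYT (?U nu). (\<Sum>u\<in>?U nu. T u - 1) + card (?U nu) = n}"
  let ?B = "{T \<in> SSYT ?S. (\<Sum>u\<in>?S. T u - 1) = n}"
  have "bij_betw (\<lambda>(nu, T). restore_ones ?S (?U nu) T) (Sigma ?H ?A) ?B"
  proof (rule bij_betw_byWitness[where f' = "\<lambda>T. (ones_strip T, \<lambda>u\<in>?U (ones_strip T). T u - 1)"];
      (intro ballI subsetI)?)
    fix p assume p: "p \<in> Sigma ?H ?A"
    then obtain nu T where [simp]: "p = (nu, T)" and nu: "nu \<in> ?H" and T: "T \<in> SSYT (?U nu)" by auto
    let ?T = "restore_ones ?S (?U nu) T"
    have T': "?T \<in> SSYT ?S" by (rule restore_ones_SSYT[OF nu T])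
    have sub: "?U nu \<subseteq> ?S" by (rule row_skew_mono[OF nu])
    have ge: "T u > 0" if "u \<in> ?U nu" for u using SSYT_D(1)[OF T that] by simp
    have U: "?U (ones_strip ?T) = ?U nu"
    proof (rule Set.set_eqI)
      fix u
      have "?T u \<noteq> 1 \<longleftrightarrow> u \<in> ?U nu" if "u \<in> ?S"
        using that ge[of u] by (simp add: restore_ones_def)
      then show "u \<in> ?U (ones_strip ?T) \<longleftrightarrow> u \<in> ?U nu"
        using mem_ones_strip_row_skew[OF T', of u] sub by blast
    qed
    \<comment> \<open>Equal cell sets give equal bounds because both bounds are at most
      \<open>lam i\<close>; beyond that the intervals would be empty and carry no
      information.\<close>
    have "ones_strip ?T i = nu i" if i: "i \<in> {1..R}" for i
    proof -
      have "{ones_strip ?T i<..lam i} = {nu i<..lam i}"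
      proof (rule Set.set_eqI)
        fix j
        have "(i, j) \<in> ?U (ones_strip ?T) \<longleftrightarrow> (i, j) \<in> ?U nu" using U by simp
        then show "j \<in> {ones_strip ?T i<..lam i} \<longleftrightarrow> j \<in> {nu i<..lam i}"
          using i by (simp add: mem_row_skew)
      qed
      moreover have "nu i \<le> lam i" using nu i by (auto simp: horizontal_strips_def)
      moreover have "ones_strip ?T i \<le> lam i" using ones_strip_bounds i by blast
      ultimately show ?thesis
        by (metis card_greaterThanAtMost diff_diff_cancel)
    qed
    then have strip: "ones_strip ?T = nu"
      using nu by (intro extensionalityI[of _ "{1..R}"]) (auto simp: ones_strip_def horizontal_strips_def)
    have "(\<lambda>u\<in>?U nu. ?T u - 1) = T"
      using SSYT_D(4)[OF T] sub by (intro extensionalityI[of _ "?U nu"]) (auto simp: restore_ones_def)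
    then show "(\<lambda>T. (ones_strip T, \<lambda>u\<in>?U (ones_strip T). T u - 1))
        ((\<lambda>(nu, T). restore_ones ?S (?U nu) T) p) = p"
      by (simp add: strip)
  next
    fix T assume "T \<in> ?B"
    then have T: "T \<in> SSYT ?S" by simp
    have "T u \<noteq> 0" if "u \<in> ?S" for u using SSYT_D(1)[OF T that] by simp
    then show "(\<lambda>(nu, T). restore_ones ?S (?U nu) T)
        ((\<lambda>T. (ones_strip T, \<lambda>u\<in>?U (ones_strip T). T u - 1)) T) = T"
      using SSYT_D(4)[OF T] mem_ones_strip_row_skew[OF T]
      by (intro extensionalityI[of _ ?S]) (auto simp: restore_ones_def)
  next
    fix T assume "T \<in> (\<lambda>(nu, T). restore_ones ?S (?U nu) T) ` Sigma ?H ?A"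
    then show "T \<in> ?B" using restore_ones_SSYT weight_restore_ones by auto
  next
    fix p assume "p \<in> (\<lambda>T. (ones_strip T, \<lambda>u\<in>?U (ones_strip T). T u - 1)) ` ?B"
    then obtain T where p: "p = (ones_strip T, \<lambda>u\<in>?U (ones_strip T). T u - 1)"
      and T: "T \<in> SSYT ?S" and w: "(\<Sum>u\<in>?S. T u - 1) = n" by auto
    let ?T = "\<lambda>u\<in>?U (ones_strip T). T u - 1"
    have "T u \<noteq> 0" if "u \<in> ?S" for u using SSYT_D(1)[OF T that] by simp
    then have "restore_ones ?S (?U (ones_strip T)) ?T = T"
      using SSYT_D(4)[OF T] mem_ones_strip_row_skew[OF T]
      by (intro extensionalityI[of _ ?S]) (auto simp: restore_ones_def)
    then have "(\<Sum>u\<in>?U (ones_strip T). ?T u - 1) + card (?U (ones_strip T)) = n"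
      using weight_restore_ones[OF ones_strip_horizontal[OF T] remove_ones_SSYT[OF T]] w by simp
    then show "p \<in> Sigma ?H ?A"
      unfolding p using ones_strip_horizontal[OF T] remove_ones_SSYT[OF T] by auto
  qed
  moreover have "finite ?H"
  proof (rule finite_subset)
    show "?H \<subseteq> PiE {1..R} (\<lambda>i. {..lam i})" by (auto simp: horizontal_strips_def PiE_def)
  qed (auto intro: finite_PiE)
  moreover have "finite (?A nu)" for nu
  proof (rule finite_subset)
    show "?A nu \<subseteq> {T \<in> SSYT (?U nu). (\<Sum>u\<in>?U nu. T u - 1) = n - card (?U nu)}" by auto
  qed (rule finite_SSYT_weight[OF finite_row_skew])
  ultimately show ?thesis
    by (subst card_SigmaI[symmetric]) (auto dest: bij_betw_same_card)
qed

lemma SSYT_gf_peel: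
  "SSYT_gf (row_skew R lam mu) =
    (\<Sum>nu\<in>horizontal_strips R lam mu. fps_X ^ (\<Sum>i = 1..R. lam i - nu i) * SSYT_gf (row_skew R lam nu))"
proof (rule fps_ext)
  fix n
  have "fps_nth (fps_X ^ card (row_skew R lam nu) * SSYT_gf (row_skew R lam nu)) n =
    of_nat (card {T \<in> SSYT (row_skew R lam nu).
       (\<Sum>u\<in>row_skew R lam nu. T u - 1) + card (row_skew R lam nu) = n})" for nu
  proof -
    have "{T \<in> SSYT (row_skew R lam nu). (\<Sum>u\<in>row_skew R lam nu. T u - 1) + card (row_skew R lam nu) = n} =
      (if n < card (row_skew R lam nu) then {} else
       {T \<in> SSYT (row_skew R lam nu). (\<Sum>u\<in>row_skew R lam nu. T u - 1) = n - card (row_skew R lam nu)})"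
      by auto
    then show ?thesis
      by (simp add: SSYT_gf_def fps_X_power_mult_nth)
  qed
  note nth = this
  show "fps_nth (SSYT_gf (row_skew R lam mu)) n =
     fps_nth (\<Sum>nu\<in>horizontal_strips R lam mu. fps_X ^ (\<Sum>i = 1..R. lam i - nu i) * SSYT_gf (row_skew R lam nu)) n"
    by (simp only: fps_sum_nth card_row_skew[symmetric] nth)
      (simp only: SSYT_gf_def Abs_fps_inverse card_SSYT_weight_peel fps_nth_Abs_fps of_nat_sum)
qed

end

section \<open>Equality up to a signed power of q\<close>

context qfield
begin

text \<open>Integer exponents make these units a group, closed under quotients as well as
  products.\<close>

definition signed_power :: "'a \<Rightarrow> bool" where
  "signed_power u \<longleftrightarrow> (\<exists>k::int. u = q powi k \<or> u = - (q powi k))"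

text \<open>Compatible with products and quotients but not with sums, so differences are factored
  exactly before signs and powers of \<open>q\<close> are dropped.\<close>

definition assoc :: "'a \<Rightarrow> 'a \<Rightarrow> bool"  (infix "\<approx>\<^sub>q" 50) where
  "x \<approx>\<^sub>q y \<longleftrightarrow> (\<exists>u. signed_power u \<and> x = u * y)"

lemma signed_power_power: "signed_power (q ^ n)"
  unfolding signed_power_def by (rule exI[of _ "int n"]) simp

lemma signed_power_1: "signed_power 1"
  using signed_power_power[of 0] by simp

lemma signed_power_mult: "signed_power u \<Longrightarrow> signed_power v \<Longrightarrow> signed_power (u * v)"
  unfolding signed_power_def
  by (elim exE disjE; rule_tac x = "k + ka" in exI) (simp_all add: power_int_add q_nonzero)

lemma signed_power_uminus: "signed_power u \<Longrightarrow> signed_power (- u)"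
  unfolding signed_power_def by fastforce

lemma signed_power_inverse: "signed_power u \<Longrightarrow> signed_power (inverse u)"
  unfolding signed_power_def
  by (elim exE disjE; rule_tac x = "- k" in exI) (simp_all add: power_int_minus)

lemma signed_power_divide: "signed_power u \<Longrightarrow> signed_power v \<Longrightarrow> signed_power (u / v)"
  by (simp add: divide_inverse signed_power_mult signed_power_inverse)

lemma signed_power_pow: "signed_power u \<Longrightarrow> signed_power (u ^ n)"
  by (induction n) (simp_all add: signed_power_1 signed_power_mult)

lemma signed_power_prod: "(\<And>i. i \<in> A \<Longrightarrow> signed_power (f i)) \<Longrightarrow> signed_power (\<Prod>i\<in>A. f i)"
  by (induction A rule: infinite_finite_induct) (simp_all add: signed_power_1 signed_power_mult)

lemmas signed_power_intros = signed_power_1 signed_power_power signed_power_mult signed_power_uminus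
  signed_power_inverse signed_power_divide signed_power_pow signed_power_prod

lemma signed_power_nonzero: "signed_power u \<Longrightarrow> u \<noteq> 0"
  using q_nonzero by (auto simp: signed_power_def)

lemma assocI: "signed_power u \<Longrightarrow> x = u * y \<Longrightarrow> x \<approx>\<^sub>q y"
  by (auto simp: assoc_def)

lemma assoc_refl [simp]: "x \<approx>\<^sub>q x"
  by (rule assocI[OF signed_power_1]) simp

lemma assoc_sym: "x \<approx>\<^sub>q y \<Longrightarrow> y \<approx>\<^sub>q x"
  unfolding assoc_def using signed_power_inverse signed_power_nonzero
  by (metis left_inverse mult.assoc mult_1)

lemma assoc_trans [trans]: "x \<approx>\<^sub>q y \<Longrightarrow> y \<approx>\<^sub>q z \<Longrightarrow> x \<approx>\<^sub>q z"
  unfolding assoc_def using signed_power_mult by (metis mult.assoc)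

lemma assoc_eq_trans [trans]: "x \<approx>\<^sub>q y \<Longrightarrow> y = z \<Longrightarrow> x \<approx>\<^sub>q z"
  and eq_assoc_trans [trans]: "x = y \<Longrightarrow> y \<approx>\<^sub>q z \<Longrightarrow> x \<approx>\<^sub>q z"
  by simp_all

lemma assoc_mult: "x \<approx>\<^sub>q y \<Longrightarrow> x' \<approx>\<^sub>q y' \<Longrightarrow> x * x' \<approx>\<^sub>q y * y'"
  unfolding assoc_def using signed_power_mult by (metis mult.assoc mult.left_commute)

lemma assoc_inverse: "x \<approx>\<^sub>q y \<Longrightarrow> inverse x \<approx>\<^sub>q inverse y"
  unfolding assoc_def using signed_power_inverse by (metis inverse_mult_distrib)

lemma assoc_divide: "x \<approx>\<^sub>q y \<Longrightarrow> x' \<approx>\<^sub>q y' \<Longrightarrow> x / x' \<approx>\<^sub>q y / y'"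
  by (simp add: divide_inverse assoc_mult assoc_inverse)

lemma assoc_prod: "(\<And>i. i \<in> A \<Longrightarrow> f i \<approx>\<^sub>q g i) \<Longrightarrow> (\<Prod>i\<in>A. f i) \<approx>\<^sub>q (\<Prod>i\<in>A. g i)"
  by (induction A rule: infinite_finite_induct) (simp_all add: assoc_mult)

lemma assoc_cancel:
  assumes "x * z \<approx>\<^sub>q y * z'" "z \<approx>\<^sub>q z'" "z \<noteq> 0"
  shows "x \<approx>\<^sub>q y"
proof -
  have "z' \<noteq> 0" using assms by (auto simp: assoc_def)
  then show ?thesis using assoc_divide[OF assms(1,2)] assms(3) by simp
qed

lemma assoc_signed_power_mult: "signed_power u \<Longrightarrow> u * x \<approx>\<^sub>q x"
  by (rule assocI) auto

lemma assoc_divide_signed_power: "signed_power u \<Longrightarrow> x / u \<approx>\<^sub>q x"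
  by (rule assocI[of "inverse u"]) (simp_all add: signed_power_inverse divide_inverse mult.commute)

lemma power_diff_assoc: "j \<le> i \<Longrightarrow> q ^ i - q ^ j \<approx>\<^sub>q 1 - q ^ (i - j)"
  by (rule assocI[of "- (q ^ j)"])
    (auto intro: signed_power_intros simp: algebra_simps simp flip: power_add)

section \<open>The Jacobi-Trudi determinant in factorial powers\<close>

text \<open>Apart from \<open>1 / qfact l\<close> this is a polynomial of degree \<open>k\<close> in
  \<open>q ^ l\<close>; for \<open>k > l\<close> the factor with \<open>t = l\<close> supplies the
  zero. The induction step is \<open>h_diff\<close> solved for \<open>h l (Suc k)\<close>.\<close>

lemma h_factorial: "h l k = 1 / qfact l * (\<Prod>t<k. - 1 / q ^ t) * (\<Prod>t<k. q ^ l - q ^ t)"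
proof (induction k)
  case (Suc k)
  have "h l (Suc k) = h l k * (1 - q ^ l / q ^ k)"
    using h_diff[of l k] by (simp add: algebra_simps)
  also have "1 - q ^ l / q ^ k = - 1 / q ^ k * (q ^ l - q ^ k)"
    using q_nonzero by (simp add: field_simps)
  finally show ?case by (simp only: Suc prod.lessThan_Suc mult_ac)
qed (simp add: h_def)

lemma jacobi_trudi_assoc:
  "jacobi_trudi R l k \<approx>\<^sub>q (\<Prod>i<R. 1 / qfact (l i)) * Det R (\<lambda>i j. \<Prod>t<k j. q ^ l i - q ^ t)"
proof (rule assocI)
  show "signed_power (\<Prod>j<R. \<Prod>t<k j. - 1 / q ^ t)" by (intro signed_power_intros)
  have "jacobi_trudi R l k = Det R (\<lambda>i j. h (l i) (k j))"
    unfolding jacobi_trudi_def by (rule Det_transpose[of R "\<lambda>i j. h (l i) (k j)"])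
  also have "\<dots> = (\<Prod>i<R. 1 / qfact (l i)) * (\<Prod>j<R. \<Prod>t<k j. - 1 / q ^ t) *
      Det R (\<lambda>i j. \<Prod>t<k j. q ^ l i - q ^ t)"
    unfolding h_factorial Det_scale ..
  finally show "jacobi_trudi R l k = (\<Prod>j<R. \<Prod>t<k j. - 1 / q ^ t) *
     ((\<Prod>i<R. 1 / qfact (l i)) * Det R (\<lambda>i j. \<Prod>t<k j. q ^ l i - q ^ t))"
    by (simp only: mult_ac)
qed

end

section \<open>The determinant of the box\<close>

locale qfield_step = qfield +
  fixes m a :: nat
begin

definition p where "p = q ^ Suc m"

text \<open>The shifted factorial \<open>(p;p)_n\<close>.\<close>

definition pfact :: "nat \<Rightarrow> 'a" where "pfact n = (\<Prod>k<n. 1 - p ^ Suc k)"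

text \<open>The shifted factorial \<open>(z;p)_M\<close>; up to a signed power it is the value of
  \<open>Q\<close> at the nodes of the shape.\<close>

definition psi :: "nat \<Rightarrow> 'a \<Rightarrow> 'a" where "psi M z = (\<Prod>s<M. 1 - z * p ^ s)"

text \<open>Multiplied by \<open>psi beta z\<close>, the polynomials \<open>window beta t\<close> are products over windows of
  \<open>beta + a - 1\<close> consecutive powers of \<open>p\<close>, a form that is stable under \<open>q\<close>-differences.\<close>

definition window :: "nat \<Rightarrow> nat \<Rightarrow> 'a poly" where
  "window beta t = (\<Prod>k<t. [:1, - (1 / p ^ Suc k):]) * (\<Prod>s<a - 1 - t. [:1, - (p ^ (beta + s)):])"

definition window_det :: "nat \<Rightarrow> 'a" where
  "window_det beta = Det a (\<lambda>k t. coeff (window beta t) k)"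

text \<open>The form suited to elimination: the columns \<open>Q x^t\<close> are replaced by shifted
  copies of a single \<open>psi\<close>, so that one difference rule serves all of them.\<close>

definition elim_det :: "nat \<Rightarrow> nat \<Rightarrow> 'a \<Rightarrow> 'a" where
  "elim_det c M z = Det (c + a) (\<lambda>i j. if j < c then (z * p ^ i) ^ j else psi M (z * p ^ i / p ^ (j - c)))"

lemma p_nonzero: "p \<noteq> 0"
  by (simp add: p_def q_nonzero)

lemma p_power: "p ^ k = q ^ (Suc m * k)"
  unfolding p_def by (rule power_mult[symmetric])

lemma p_power_neq_1: "k > 0 \<Longrightarrow> 1 - p ^ k \<noteq> 0"
  using q_power_neq_1[of "Suc m * k"] by (simp add: p_power)

lemma pfact_nonzero: "pfact n \<noteq> 0"
  using p_power_neq_1 by (simp add: pfact_def del: power_Suc)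

lemma signed_power_p: "signed_power (p ^ k)" "signed_power p"
  unfolding p_def by (intro signed_power_intros)+

lemma p_diff_assoc:
  assumes "j \<le> i"
  shows "p ^ i - p ^ j \<approx>\<^sub>q 1 - p ^ (i - j)"
  using power_diff_assoc[of "Suc m * j" "Suc m * i"] assms
  by (simp add: p_power diff_mult_distrib2 del: mult_Suc)

lemma inverse_p_diff_assoc: "1 - 1 / p ^ i \<approx>\<^sub>q 1 - p ^ i"
  by (rule assocI[of "- (1 / p ^ i)"])
    (auto intro!: signed_power_intros signed_power_p simp: p_nonzero field_simps)

lemma pfact_reverse: "(\<Prod>k<n. 1 - p ^ (n - k)) = pfact n"
  unfolding pfact_def using prod.nat_diff_reindex[of "\<lambda>k. 1 - p ^ Suc k" n]
  by (simp add: Suc_diff_Suc del: power_Suc cong: prod.cong_simp)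

text \<open>Each difference of two nodes is a signed power times
  \<open>1 - p ^ (i - k)\<close>.\<close>

lemma Vandermonde_geometric:
  assumes "signed_power u"
  shows "Vandermonde n (\<lambda>i. u * p ^ i) \<approx>\<^sub>q (\<Prod>i<n. pfact i)"
  unfolding Vandermonde_eq
proof (rule assoc_prod)
  fix i
  have "(\<Prod>k<i. u * p ^ i - u * p ^ k) \<approx>\<^sub>q (\<Prod>k<i. 1 - p ^ (i - k))"
  proof (rule assoc_prod)
    fix k assume "k \<in> {..<i}"
    then have "p ^ i - p ^ k \<approx>\<^sub>q 1 - p ^ (i - k)" by (intro p_diff_assoc) auto
    then show "u * p ^ i - u * p ^ k \<approx>\<^sub>q 1 - p ^ (i - k)"
      using assoc_trans[OF assoc_signed_power_mult[OF assms]] by (simp add: right_diff_distrib[symmetric])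
  qed
  also have "(\<Prod>k<i. 1 - p ^ (i - k)) = pfact i"
    by (rule pfact_reverse)
  finally show "(\<Prod>k<i. u * p ^ i - u * p ^ k) \<approx>\<^sub>q pfact i" .
qed

section \<open>Elimination of columns by differences\<close>

text \<open>Both terms share \<open>psi M (p * z)\<close>; the leftover factors are
  \<open>1 - z * p ^ Suc M\<close> and \<open>1 - z\<close>.\<close>

lemma psi_difference: "psi (Suc M) (p * z) - psi (Suc M) z = z * (1 - p ^ Suc M) * psi M (p * z)"
proof -
  have "psi (Suc M) z = (1 - z) * psi M (p * z)"
    unfolding psi_def prod.lessThan_Suc_shift by (simp add: mult_ac)
  moreover have "psi (Suc M) (p * z) = psi M (p * z) * (1 - z * p ^ Suc M)"
    unfolding psi_def by (simp add: mult_ac)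
  ultimately show ?thesis by (simp add: algebra_simps)
qed

text \<open>Neighbouring nodes differ by the factor \<open>p\<close>, so row differences drop the
  constant column and, once the common row factor \<open>z * p ^ i\<close> is taken out, lower each
  power and \<open>M\<close> by one. Writing the rest at the later node moves the start to
  \<open>p * z\<close>.\<close>

lemma elim_det_Suc:
  assumes z: "signed_power z"
  shows "elim_det (Suc c) (Suc M) z \<approx>\<^sub>q pfact c * (1 - p ^ Suc M) ^ a * elim_det c M (p * z)"
proof -
  let ?c = "\<lambda>j. if j < c then (p ^ Suc j - 1) / p ^ j else (1 - p ^ Suc M) / p ^ (j - c)"
  let ?f = "\<lambda>i j. if j < Suc c then (z * p ^ i) ^ j else psi (Suc M) (z * p ^ i / p ^ (j - Suc c))"
  have "elim_det (Suc c) (Suc M) z = Det (c + a) (\<lambda>i j. ?f (Suc i) (Suc j) - ?f i (Suc j))"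
    unfolding elim_det_def add_Suc by (rule Det_row_differences_Suc) simp
  also have "\<dots> = Det (c + a) (\<lambda>i j. z * p ^ i * ?c j *
      (if j < c then (p * z * p ^ i) ^ j else psi M (p * z * p ^ i / p ^ (j - c))))"
  proof (rule Det_cong)
    fix i j
    show "?f (Suc i) (Suc j) - ?f i (Suc j) = z * p ^ i * ?c j *
      (if j < c then (p * z * p ^ i) ^ j else psi M (p * z * p ^ i / p ^ (j - c)))"
    proof (cases "j < c")
      case True
      have "(z * p ^ Suc i) ^ Suc j - (z * p ^ i) ^ Suc j = z * p ^ i * (p ^ Suc j - 1) * (z * p ^ i) ^ j"
        by (simp add: power_mult_distrib algebra_simps)
      also have "(z * p ^ i) ^ j = 1 / p ^ j * (p * z * p ^ i) ^ j"
        using p_nonzero by (simp add: power_mult_distrib)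
      finally show ?thesis using True by simp
    next
      case False
      have "p * (z * p ^ i / p ^ (j - c)) = z * p ^ Suc i / p ^ (j - c)" by simp
      from psi_difference[of M "z * p ^ i / p ^ (j - c)", unfolded this] False
      show ?thesis by (simp add: mult_ac)
    qed
  qed
  also have "\<dots> = (\<Prod>i<c + a. z * p ^ i) * (\<Prod>j<c + a. ?c j) * elim_det c M (p * z)"
    unfolding Det_scale elim_det_def ..
  also have "\<dots> \<approx>\<^sub>q (\<Prod>j<c + a. ?c j) * elim_det c M (p * z)"
    unfolding mult.assoc
    by (intro assoc_signed_power_mult signed_power_intros z signed_power_p)
  also have "\<dots> = (\<Prod>j<c. (p ^ Suc j - 1) / p ^ j) * (\<Prod>j<a. (1 - p ^ Suc M) / p ^ j) * elim_det c M (p * z)"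
    unfolding prod_lessThan_add by (intro arg_cong2[where f = "(*)"] prod.cong) auto
  also have "\<dots> \<approx>\<^sub>q pfact c * (1 - p ^ Suc M) ^ a * elim_det c M (p * z)"
  proof (intro assoc_mult)
    show "(\<Prod>j<c. (p ^ Suc j - 1) / p ^ j) \<approx>\<^sub>q pfact c"
      unfolding pfact_def
    proof (rule assoc_prod)
      fix j
      show "(p ^ Suc j - 1) / p ^ j \<approx>\<^sub>q 1 - p ^ Suc j"
      proof (rule assocI)
        show "signed_power (- (1 / p ^ j))" by (intro signed_power_intros signed_power_p)
        show "(p ^ Suc j - 1) / p ^ j = - (1 / p ^ j) * (1 - p ^ Suc j)"
          using p_nonzero by (simp add: field_simps)
      qed
    qed
    have "(\<Prod>j<a. (1 - p ^ Suc M) / p ^ j) \<approx>\<^sub>q (\<Prod>j<a. 1 - p ^ Suc M)"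
      by (intro assoc_prod assoc_divide_signed_power signed_power_p)
    then show "(\<Prod>j<a. (1 - p ^ Suc M) / p ^ j) \<approx>\<^sub>q (1 - p ^ Suc M) ^ a" by simp
  qed simp
  finally show ?thesis .
qed

lemma elim_det_eliminate:
  assumes "signed_power z"
  shows "elim_det c (M + c) z \<approx>\<^sub>q (\<Prod>k<c. pfact k * (1 - p ^ (M + Suc k)) ^ a) * elim_det 0 M (p ^ c * z)"
  using assms
proof (induction c arbitrary: z)
  case (Suc c)
  have "elim_det (Suc c) (M + Suc c) z \<approx>\<^sub>q pfact c * (1 - p ^ Suc (M + c)) ^ a * elim_det c (M + c) (p * z)"
    using elim_det_Suc[OF Suc.prems, of c "M + c"] by simp
  also have "\<dots> \<approx>\<^sub>q pfact c * (1 - p ^ Suc (M + c)) ^ a *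
      ((\<Prod>k<c. pfact k * (1 - p ^ (M + Suc k)) ^ a) * elim_det 0 M (p ^ c * (p * z)))"
    by (intro assoc_mult Suc.IH signed_power_intros signed_power_p Suc.prems assoc_refl)
  also have "\<dots> = (\<Prod>k<Suc c. pfact k * (1 - p ^ (M + Suc k)) ^ a) * elim_det 0 M (p ^ Suc c * z)"
    by (simp add: mult_ac)
  finally show ?case .
qed simp

section \<open>Window polynomials\<close>

lemma poly_window:
  "poly (window beta t) z = (\<Prod>k<t. 1 - z / p ^ Suc k) * (\<Prod>s<a - 1 - t. 1 - z * p ^ (beta + s))"
  unfolding window_def by (simp add: poly_prod)

text \<open>On the left the exponents of \<open>p\<close> run from \<open>-t\<close> to
  \<open>beta + a - 2 - t\<close>. For every \<open>t < a\<close> this interval contains those from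
  \<open>0\<close> to \<open>beta - 1\<close>, which make up \<open>psi beta z\<close>; the factors
  on either side form the window.\<close>

lemma psi_window:
  assumes "t < a"
  shows "psi (beta + (a - 1)) (z / p ^ t) = psi beta z * poly (window beta t) z"
proof -
  have e: "beta + (a - 1) = t + (beta + (a - 1 - t))" using assms by simp
  have "(\<Prod>s<t. 1 - z / p ^ t * p ^ s) = (\<Prod>s<t. 1 - z / p ^ Suc (t - Suc s))"
  proof (rule prod.cong[OF refl])
    fix s assume "s \<in> {..<t}"
    then have "p ^ t = p ^ s * p ^ Suc (t - Suc s)" by (subst power_add[symmetric]) simp
    then show "1 - z / p ^ t * p ^ s = 1 - z / p ^ Suc (t - Suc s)"
      using p_nonzero by (simp del: power_Suc)
  qed
  also have "\<dots> = (\<Prod>k<t. 1 - z / p ^ Suc k)"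
    by (rule prod.nat_diff_reindex)
  finally have 1: "(\<Prod>s<t. 1 - z / p ^ t * p ^ s) = (\<Prod>k<t. 1 - z / p ^ Suc k)" .
  have 2: "z / p ^ t * p ^ (t + s) = z * p ^ s" for s
    using p_nonzero by (simp add: power_add)
  show ?thesis
    unfolding e psi_def prod_lessThan_add poly_window 1 2 by (simp only: mult_ac)
qed

lemma degree_window:
  assumes "t < a"
  shows "degree (window beta t) < a"
proof -
  have le: "degree (\<Prod>k<n. [:1, f k:]) \<le> n" for n and f :: "nat \<Rightarrow> 'a"
  proof (induction n)
    case (Suc n)
    have "degree [:1, f n:] \<le> 1" by simp
    then show ?case using Suc degree_mult_le[of "\<Prod>k<n. [:1, f k:]" "[:1, f n:]"]
      by (simp only: prod.lessThan_Suc)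
  qed simp
  have "degree (window beta t) \<le> t + (a - 1 - t)"
    unfolding window_def by (rule order_trans[OF degree_mult_le add_mono[OF le le]])
  then show ?thesis using assms by simp
qed

text \<open>Windows have degree below \<open>a\<close>, hence arise from the powers by a change of
  basis with determinant \<open>window_det\<close>.\<close>

lemma elim_det_window:
  assumes "a > 0"
  shows "elim_det c (b + c + (a - 1)) z = Det (c + a) (\<lambda>i j. if j < c then (z * p ^ i) ^ j
      else psi (b + c) (z * p ^ i) * (z * p ^ i) ^ (j - c)) * window_det (b + c)"
proof -
  let ?x = "\<lambda>i. z * p ^ i"
  have "elim_det c (b + c + (a - 1)) z = Det (c + a) (\<lambda>i j. if j < c then 1 * poly (monom 1 j) (?x i)
      else psi (b + c) (?x i) * poly (window (b + c) (j - c)) (?x i))"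
    unfolding elim_det_def
    by (rule Det_cong) (auto simp: poly_monom psi_window[symmetric])
  also have "\<dots> = Det (c + a) (\<lambda>i j. if j < c then 1 * ?x i ^ j else psi (b + c) (?x i) * ?x i ^ (j - c)) *
      (Det c (\<lambda>k j. coeff (monom 1 j) k) * Det a (\<lambda>k j. coeff (window (b + c) j) k))"
    by (rule Det_polys) (auto simp: degree_monom_eq degree_window)
  also have "Det c (\<lambda>k j. coeff (monom 1 j) k) = (1::'a)"
    by (rule Det_coeff_monic) (auto simp: degree_monom_eq)
  finally show ?thesis by (simp only: window_det_def mult_1_left)
qed

text \<open>With no pure powers left, the row factors \<open>psi b\<close> come out and a
  Vandermonde determinant of size \<open>a\<close> remains.\<close>

lemma elim_det_0_window:
  "elim_det 0 (b + (a - 1)) z =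
    (\<Prod>i<a. psi b (z * p ^ i)) * Vandermonde a (\<lambda>i. z * p ^ i) * window_det b"
proof -
  have "elim_det 0 (b + (a - 1)) z = Det a (\<lambda>i j. psi b (z * p ^ i) * 1 * poly (window b j) (z * p ^ i))"
    unfolding elim_det_def add_0_left by (rule Det_cong) (simp add: psi_window[symmetric])
  also have "\<dots> = (\<Prod>i<a. psi b (z * p ^ i)) * Det a (\<lambda>i j. poly (window b j) (z * p ^ i))"
    unfolding Det_scale by simp
  finally show ?thesis
    by (simp add: Det_polys_Vandermonde degree_window window_det_def mult.assoc)
qed

text \<open>The value of \<open>window_det beta\<close> up to a signed power, for
  \<open>a = Suc n\<close>.\<close>

definition window_prod :: "nat \<Rightarrow> nat \<Rightarrow> 'a" where
  "window_prod n beta = (\<Prod>k<n. \<Prod>i<Suc k. 1 - p ^ (beta + (n - k) + i))"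

lemma window_prod_nonzero: "window_prod n beta \<noteq> 0"
proof -
  have "1 - p ^ (beta + (n - k) + i) \<noteq> 0" if "k < n" for k i
    using p_power_neq_1[of "beta + (n - k) + i"] that by simp
  then show ?thesis by (simp add: window_prod_def del: prod.lessThan_Suc)
qed

text \<open>The exponents in the product for \<open>k\<close> run from \<open>beta + n - k\<close>
  to \<open>beta + n\<close>. Raising \<open>beta\<close> shifts them by one, trading the lowest
  factor for \<open>1 - p ^ (beta + Suc n)\<close>, which does not depend on
  \<open>k\<close>.\<close>

lemma window_prod_Suc: "window_prod n (Suc beta) * (\<Prod>k<n. 1 - p ^ (beta + Suc k)) = window_prod n beta * (1 - p ^ (beta + Suc n)) ^ n"
proof -
  have "(\<Prod>k<n. 1 - p ^ (beta + Suc k)) = (\<Prod>k<n. 1 - p ^ (beta + Suc (n - Suc k)))"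
    by (rule prod.nat_diff_reindex[symmetric])
  then have "window_prod n (Suc beta) * (\<Prod>k<n. 1 - p ^ (beta + Suc k)) =
     (\<Prod>k<n. (\<Prod>i<Suc k. 1 - p ^ (Suc beta + (n - k) + i)) * (1 - p ^ (beta + Suc (n - Suc k))))"
    by (simp only: window_prod_def prod.distrib)
  also have "\<dots> = (\<Prod>k<n. (\<Prod>i<Suc k. 1 - p ^ (beta + (n - k) + i)) * (1 - p ^ (beta + Suc n)))"
  proof (rule prod.cong[OF refl])
    fix k assume "k \<in> {..<n}"
    then have k: "Suc (n - Suc k) = n - k" "beta + (n - k) + Suc k = beta + Suc n" by auto
    have "(\<Prod>i<Suc k. f i) * f (Suc k) = f 0 * (\<Prod>i<Suc k. f (Suc i))" for f :: "nat \<Rightarrow> 'a"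
      unfolding prod.lessThan_Suc_shift[symmetric] by (rule prod.lessThan_Suc[symmetric])
    from this[of "\<lambda>i. 1 - p ^ (beta + (n - k) + i)", unfolded k(2)]
    show "(\<Prod>i<Suc k. 1 - p ^ (Suc beta + (n - k) + i)) * (1 - p ^ (beta + Suc (n - Suc k))) =
       (\<Prod>i<Suc k. 1 - p ^ (beta + (n - k) + i)) * (1 - p ^ (beta + Suc n))"
      by (simp only: k(1) add_Suc add_Suc_right add_0_right mult_ac)
  qed
  finally show ?thesis by (simp only: prod.distrib window_prod_def prod_constant card_lessThan)
qed

text \<open>Evaluated at \<open>0\<close> and at the roots of the right factors, the window polynomials form a
  triangular matrix.\<close>

lemma window_det_assoc:
  assumes a: "a = Suc n"
  shows "window_det beta \<approx>\<^sub>q window_prod n beta"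
proof -
  \<comment> \<open>For \<open>i > 0\<close>, \<open>y i\<close> is the root of the right factor
    with index \<open>s = n - i\<close>, which occurs in \<open>window beta t\<close> exactly when
    \<open>t < i\<close>. At the node \<open>0\<close> all windows equal \<open>1\<close>.\<close>
  define y where "y i = (if i = 0 then 0 else 1 / p ^ (beta + (n - i)))" for i
  have "Vandermonde a y * window_det beta = Det a (\<lambda>i t. poly (window beta t) (y i))"
    unfolding window_det_def by (rule Det_polys_Vandermonde[symmetric]) (rule degree_window)
  also have "\<dots> = (\<Prod>i<a. poly (window beta i) (y i))"
  proof (rule Det_upper_triangular)
    fix i t assume ti: "t < i" "i < a"
    then have "n - i \<in> {..<a - 1 - t}" "1 - y i * p ^ (beta + (n - i)) = 0"
      using p_nonzero by (auto simp: y_def a)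
    then have "(\<Prod>s<a - 1 - t. 1 - y i * p ^ (beta + s)) = 0"
      by (intro prod_zero) blast+
    then show "poly (window beta t) (y i) = 0" by (simp add: poly_window)
  qed
  also have "\<dots> = (\<Prod>k<n. poly (window beta (Suc k)) (y (Suc k)))"
  proof -
    have "(\<Prod>i<a. g i) = g 0 * (\<Prod>k<n. g (Suc k))" for g :: "nat \<Rightarrow> 'a"
      unfolding a by (rule prod.lessThan_Suc_shift)
    moreover have "poly (window beta 0) (y 0) = 1" by (simp add: poly_window y_def)
    ultimately show ?thesis by simp
  qed
  also have "\<dots> \<approx>\<^sub>q (\<Prod>k<n. (\<Prod>i<Suc k. 1 - p ^ (beta + (n - k) + i)) * pfact (n - Suc k))"
  proof (rule assoc_prod)
    fix k assume "k \<in> {..<n}"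
    then have k: "n - k = Suc (n - Suc k)" by auto
    have 1: "(\<Prod>i<Suc k. 1 - y (Suc k) / p ^ Suc i) \<approx>\<^sub>q (\<Prod>i<Suc k. 1 - p ^ (beta + (n - k) + i))"
    proof (rule assoc_prod)
      fix i
      have "y (Suc k) / p ^ Suc i = 1 / p ^ (beta + (n - k) + i)"
        unfolding y_def k by (simp add: power_add mult_ac)
      then show "1 - y (Suc k) / p ^ Suc i \<approx>\<^sub>q 1 - p ^ (beta + (n - k) + i)"
        by (simp only: inverse_p_diff_assoc)
    qed
    have 2: "(\<Prod>s<n - Suc k. 1 - y (Suc k) * p ^ (beta + s)) \<approx>\<^sub>q (\<Prod>s<n - Suc k. 1 - p ^ (n - Suc k - s))"
    proof (rule assoc_prod)
      fix s assume "s \<in> {..<n - Suc k}"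
      then have "p ^ (beta + (n - Suc k)) = p ^ (beta + s) * p ^ (n - Suc k - s)"
        by (subst power_add[symmetric]) simp
      then have "y (Suc k) * p ^ (beta + s) = 1 / p ^ (n - Suc k - s)"
        using p_nonzero by (simp add: y_def)
      then show "1 - y (Suc k) * p ^ (beta + s) \<approx>\<^sub>q 1 - p ^ (n - Suc k - s)"
        by (simp only: inverse_p_diff_assoc)
    qed
    show "poly (window beta (Suc k)) (y (Suc k)) \<approx>\<^sub>q
       (\<Prod>i<Suc k. 1 - p ^ (beta + (n - k) + i)) * pfact (n - Suc k)"
      using assoc_mult[OF 1 2] unfolding pfact_reverse poly_window by (simp add: a)
  qed
  also have "\<dots> = window_prod n beta * (\<Prod>k<n. pfact k)"
    unfolding prod.distrib window_prod_def[symmetric] prod.nat_diff_reindex ..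
  finally have *: "window_det beta * Vandermonde a y \<approx>\<^sub>q window_prod n beta * (\<Prod>k<n. pfact k)"
    by (simp only: mult.commute)
  \<comment> \<open>The node \<open>0\<close> contributes only the unit \<open>y (Suc i)\<close> to
    each row, the other nodes a geometric Vandermonde product; the result cancels the
    \<open>pfact\<close> product obtained above.\<close>
  have V: "Vandermonde a y \<approx>\<^sub>q (\<Prod>k<n. pfact k)"
  proof -
    have "Vandermonde a y = (\<Prod>i<n. \<Prod>k<Suc i. y (Suc i) - y k)"
      unfolding Vandermonde_eq a prod.lessThan_Suc_shift[of _ n] by (simp del: prod.lessThan_Suc)
    also have "\<dots> \<approx>\<^sub>q (\<Prod>i<n. pfact i)"
    proof (rule assoc_prod)
      fix i assume i: "i \<in> {..<n}"
      have "(\<Prod>k<Suc i. y (Suc i) - y k) = y (Suc i) * (\<Prod>k<i. y (Suc i) - y (Suc k))"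
        unfolding prod.lessThan_Suc_shift by (simp add: y_def)
      also have "\<dots> \<approx>\<^sub>q (\<Prod>k<i. y (Suc i) - y (Suc k))"
        by (rule assoc_signed_power_mult) (auto intro!: signed_power_intros signed_power_p simp: y_def)
      also have "\<dots> \<approx>\<^sub>q (\<Prod>k<i. 1 - p ^ (i - k))"
      proof (rule assoc_prod)
        fix k assume k: "k \<in> {..<i}"
        have "p ^ (beta + (n - Suc k)) = p ^ (beta + (n - Suc i)) * p ^ (i - k)"
          using i k by (subst power_add[symmetric]) simp
        then have "y (Suc i) - y (Suc k) = 1 / p ^ (beta + (n - Suc i)) * (1 - 1 / p ^ (i - k))"
          using p_nonzero by (simp add: y_def right_diff_distrib)
        also have "\<dots> \<approx>\<^sub>q 1 - 1 / p ^ (i - k)"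
          by (intro assoc_signed_power_mult signed_power_intros signed_power_p)
        also have "\<dots> \<approx>\<^sub>q 1 - p ^ (i - k)" by (rule inverse_p_diff_assoc)
        finally show "y (Suc i) - y (Suc k) \<approx>\<^sub>q 1 - p ^ (i - k)" .
      qed
      also have "\<dots> = pfact i" by (rule pfact_reverse)
      finally show "(\<Prod>k<Suc i. y (Suc i) - y k) \<approx>\<^sub>q pfact i" .
    qed
    finally show ?thesis .
  qed
  have "(\<Prod>k<n. pfact k) \<noteq> 0" by (simp add: pfact_nonzero)
  then have "Vandermonde a y \<noteq> 0" using V signed_power_nonzero by (auto simp: assoc_def)
  with * V show ?thesis by (rule assoc_cancel)
qed

section \<open>The box product\<close>

text \<open>MacMahon's product for a box with sides \<open>a\<close>, \<open>b\<close>,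
  \<open>c\<close> in base \<open>p\<close>, with the product over the side \<open>b\<close> already
  telescoped.\<close>

definition box :: "nat \<Rightarrow> nat \<Rightarrow> 'a" where
  "box b c = (\<Prod>k<c. \<Prod>i<a. (1 - p ^ (b + k + Suc i)) / (1 - p ^ (k + Suc i)))"

text \<open>The balance of the factors at the two ends of the elimination. From \<open>c\<close> to
  \<open>Suc c\<close> the windows change by \<open>window_prod_Suc\<close>, and the new
  \<open>pfact (c + a)\<close> cancels the denominators of the new box factors up to
  \<open>pfact c\<close>.\<close>

lemma box_telescope:
  assumes a: "a = Suc n"
  shows "window_prod n (b + c) * (\<Prod>i<c + a. pfact i) * box b c =
    (\<Prod>k<c. pfact k * (1 - p ^ (b + n + Suc k)) ^ a) * (\<Prod>i<a. pfact i) * window_prod n b"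
proof (induction c)
  case (Suc c)
  let ?P = "\<Prod>k<n. 1 - p ^ (b + c + Suc k)" and ?N = "\<Prod>i<a. 1 - p ^ (c + Suc i)"
  let ?t = "1 - p ^ (b + n + Suc c)"
  have t: "1 - p ^ (b + c + Suc n) = ?t" by (simp add: add_ac)
  have N: "?N \<noteq> 0" using p_power_neq_1 by (simp del: power_Suc add_Suc_right)
  have 1: "window_prod n (b + Suc c) * ?P = window_prod n (b + c) * ?t ^ n"
    using window_prod_Suc[of n "b + c"] unfolding t by (simp only: add_Suc_right)
  have 2: "(\<Prod>i<Suc c + a. pfact i) = (\<Prod>i<c + a. pfact i) * pfact (c + a)" by simp
  have 3: "pfact (c + a) = pfact c * ?N"
    unfolding pfact_def prod_lessThan_add by (simp only: add_Suc_right)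
  have "(\<Prod>i<a. 1 - p ^ (b + c + Suc i)) = ?P * ?t"
    unfolding a prod.lessThan_Suc t ..
  then have 4: "box b (Suc c) = box b c * (?P * ?t / ?N)"
    unfolding box_def by (simp only: prod.lessThan_Suc prod_dividef times_divide_times_eq)
  have "window_prod n (b + Suc c) * (\<Prod>i<Suc c + a. pfact i) * box b (Suc c) =
    (window_prod n (b + Suc c) * ?P) * (\<Prod>i<c + a. pfact i) * box b c * pfact c * ?t"
    unfolding 2 3 4 using N by (simp add: field_simps)
  also have "\<dots> = (window_prod n (b + c) * (\<Prod>i<c + a. pfact i) * box b c) * (pfact c * ?t ^ a)"
    unfolding 1 a by (simp add: mult_ac)
  finally show ?case unfolding Suc by (simp add: mult_ac)
qed (simp add: box_def)

text \<open>Multiplying by \<open>window_det (b + c)\<close> turns the determinant into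
  \<open>elim_det\<close>; elimination removes the \<open>c\<close> power columns, the rest factors,
  and the window determinant is cancelled against its product form.\<close>

lemma box_det_assoc:
  assumes z: "signed_power z"
  shows "Det (c + a) (\<lambda>i j. if j < c then (z * p ^ i) ^ j
      else psi (b + c) (z * p ^ i) * (z * p ^ i) ^ (j - c)) \<approx>\<^sub>q
    (\<Prod>i<c + a. pfact i) * (box b c * (\<Prod>i<a. psi b (p ^ c * z * p ^ i)))" (is "?D \<approx>\<^sub>q _")
proof (cases a)
  \<comment> \<open>Windows require \<open>a > 0\<close>; for \<open>a = 0\<close> only the power
    columns exist.\<close>
  case 0
  have "?D = Det c (\<lambda>i j. if j < c then (z * p ^ i) ^ j
      else psi (b + c) (z * p ^ i) * (z * p ^ i) ^ (j - c))" by (simp add: 0)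
  also have "\<dots> = Vandermonde c (\<lambda>i. z * p ^ i)" by (rule Det_cong) simp
  also have "\<dots> \<approx>\<^sub>q (\<Prod>i<c. pfact i)" by (rule Vandermonde_geometric[OF z])
  also have "\<dots> = (\<Prod>i<c + a. pfact i) * (box b c * (\<Prod>i<a. psi b (p ^ c * z * p ^ i)))"
    unfolding box_def by (simp add: 0)
  finally show ?thesis .
next
  case (Suc n)
  let ?X = "\<Prod>i<a. psi b (p ^ c * z * p ^ i)"
  let ?G = "\<Prod>k<c. pfact k * (1 - p ^ (b + n + Suc k)) ^ a"
  have pz: "signed_power (p ^ c * z)" by (intro signed_power_intros signed_power_p z)
  have "?D * window_det (b + c) = elim_det c (b + c + (a - 1)) z"
    by (rule elim_det_window[symmetric]) (simp add: Suc)
  also have "\<dots> = elim_det c (b + n + c) z" by (simp add: Suc add_ac)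
  also have "\<dots> \<approx>\<^sub>q ?G * elim_det 0 (b + n) (p ^ c * z)" by (rule elim_det_eliminate[OF z])
  also have "\<dots> = ?G * (?X * Vandermonde a (\<lambda>i. p ^ c * z * p ^ i) * window_det b)"
    using elim_det_0_window[of b "p ^ c * z"] by (simp add: Suc)
  also have "\<dots> \<approx>\<^sub>q ?G * (?X * (\<Prod>i<a. pfact i) * window_prod n b)"
    by (intro assoc_mult assoc_refl Vandermonde_geometric window_det_assoc pz Suc)
  also have "\<dots> = (?G * (\<Prod>i<a. pfact i) * window_prod n b) * ?X" by (simp only: mult_ac)
  also have "\<dots> = ((\<Prod>i<c + a. pfact i) * (box b c * ?X)) * window_prod n (b + c)"
    unfolding box_telescope[OF Suc, symmetric] by (simp only: mult_ac)
  finally have *: "?D * window_det (b + c) \<approx>\<^sub>q ((\<Prod>i<c + a. pfact i) * (box b c * ?X)) * window_prod n (b + c)" .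
  have w: "window_det (b + c) \<approx>\<^sub>q window_prod n (b + c)" by (rule window_det_assoc[OF Suc])
  then have "window_det (b + c) \<noteq> 0" using signed_power_nonzero window_prod_nonzero by (auto simp: assoc_def)
  with * w show ?thesis by (rule assoc_cancel)
qed

end

section \<open>Generating functions of tableaux as determinants\<close>

lemma fls_X_power_neq_1: "k > 0 \<Longrightarrow> (fls_X :: rat fls) ^ k \<noteq> 1"
proof
  assume k: "k > 0" and "(fls_X :: rat fls) ^ k = 1"
  then have "fps_to_fls (fps_X ^ k :: rat fps) = fps_to_fls 1" by (simp add: fps_to_fls_power)
  then have "(fps_X ^ k :: rat fps) = 1" by (simp only: fps_to_fls_eq_iff)
  from arg_cong[OF this, of "\<lambda>f. fps_nth f 0"] k show False by simp
qed

text \<open>Laurent series form a field containing the power series in which the variable is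
  invertible, as the determinant computations require.\<close>

interpretation fls: qfield "fls_X :: rat fls"
  by unfold_locales (simp_all add: fls_X_power_neq_1)

lemma fps_to_fls_sum: "fps_to_fls (sum f A) = (\<Sum>x\<in>A. fps_to_fls (f x))"
  by (induction A rule: infinite_finite_induct) simp_all

lemma fps_to_fls_mult: "fps_to_fls (f * g) = fps_to_fls f * fps_to_fls (g :: rat fps)"
  by (rule fls_times_fps_to_fls)

lemma fps_to_fls_prod: "fps_to_fls (prod f A) = (\<Prod>x\<in>A. fps_to_fls (f x :: rat fps))"
  by (induction A rule: infinite_finite_induct) (simp_all add: fps_to_fls_mult)

lemma SSYT_gf_empty: "SSYT_gf {} = 1"
proof (rule fps_ext)
  fix n
  have "SSYT {} = {\<lambda>_. undefined}" by (auto simp: SSYT_def)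
  then have "{T \<in> SSYT {}. (0::nat) = n} = (if n = 0 then {\<lambda>_. undefined} else {})" by auto
  then show "fps_nth (SSYT_gf {}) n = fps_nth 1 n" by (simp add: SSYT_gf_def)
qed

lemma row_skew_cong: "(\<And>i. i \<in> {1..R} \<Longrightarrow> mu i = nu i) \<Longrightarrow> row_skew R lam mu = row_skew R lam nu"
  by (auto simp: row_skew_def)

text \<open>Peeling ones gives the generating functions the recurrence and initial value required by
  \<open>jacobi_trudi_unique\<close>.\<close>

lemma SSYT_gf_jacobi_trudi:
  assumes lam: "\<And>i j. 1 \<le> i \<Longrightarrow> i \<le> j \<Longrightarrow> j \<le> R \<Longrightarrow> lam j \<le> lam i"
    and mu: "\<And>i j. 1 \<le> i \<Longrightarrow> i \<le> j \<Longrightarrow> j \<le> R \<Longrightarrow> mu j \<le> mu i"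
    and mu_lam: "\<And>i. i \<in> {1..R} \<Longrightarrow> mu i \<le> lam i"
  shows "fps_to_fls (SSYT_gf (row_skew R lam mu)) =
    fls.jacobi_trudi R (\<lambda>j. lam (R - j) + j) (\<lambda>j. mu (R - j) + j)"
proof -
  define l where "l j = lam (R - j) + j" for j
  \<comment> \<open>Recovers the parts from the shifted coordinates; the subtraction is exact
    because a strictly increasing \<open>k\<close> has \<open>k j \<ge> j\<close>.\<close>
  define part :: "(nat \<Rightarrow> nat) \<Rightarrow> nat \<Rightarrow> nat" where "part k i = k (R - i) - (R - i)" for k i
  define S where "S k = fps_to_fls (SSYT_gf (row_skew R lam (part k)))" for k
  define k0 where "k0 = (\<lambda>j\<in>{0..<R}. mu (R - j) + j)"
  have l_less: "l j < l (Suc j)" if "Suc j < R" for j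
  proof -
    have "lam (R - j) \<le> lam (R - Suc j)" using that by (intro lam) auto
    then show ?thesis by (simp add: l_def)
  qed
  have gap: "k j + (j' - j) \<le> k j'" if "\<And>j. Suc j < R \<Longrightarrow> k j < k (Suc j)" "j \<le> j'" "j' < R"
    for k :: "nat \<Rightarrow> nat" and j j'
    using that(2,3)
  proof (induction j' rule: dec_induct)
    case (step n)
    then show ?case using that(1)[of n] by simp
  qed simp
  have "S k0 = fls.jacobi_trudi R l k0"
  proof (rule fls.jacobi_trudi_unique)
    fix k assume k: "\<And>j. j < R \<Longrightarrow> k j = l j"
    have "row_skew R lam (part k) = {}"
      using k by (auto simp: row_skew_def part_def l_def)
    then show "S k = 1" by (simp add: S_def SSYT_gf_empty)
  next
    fix k assume k: "\<And>j. Suc j < R \<Longrightarrow> k j < k (Suc j)" and kl: "\<And>j. j < R \<Longrightarrow> k j \<le> l j"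
    have gapk: "k j + (j' - j) \<le> k j'" if "j \<le> j'" "j' < R" for j j'
      by (rule gap) (use k that in auto)
    have ge: "j \<le> k j" if "j < R" for j using gapk[of 0 j] that by simp
    let ?H = "horizontal_strips R lam (part k)"
    have "SSYT_gf (row_skew R lam (part k)) =
      (\<Sum>nu\<in>?H. fps_X ^ (\<Sum>i = 1..R. lam i - nu i) * SSYT_gf (row_skew R lam nu))"
    proof (rule SSYT_gf_peel[OF lam])
      show "part k j \<le> part k i" if "1 \<le> i" "i \<le> j" "j \<le> R" for i j
      proof -
        have "k (R - j) + ((R - i) - (R - j)) \<le> k (R - i)" using that by (intro gapk) auto
        then show ?thesis using that unfolding part_def by linarith
      qed
      show "part k i \<le> lam i" if "i \<in> {1..R}" for i
        using kl[of "R - i"] that by (simp add: part_def l_def) linarith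
    qed
    then have "S k = (\<Sum>nu\<in>?H. fls_X ^ (\<Sum>i = 1..R. lam i - nu i) * fps_to_fls (SSYT_gf (row_skew R lam nu)))"
      by (simp only: S_def fps_to_fls_sum fps_to_fls_mult fps_to_fls_power fps_X_to_fls)
    also have "\<dots> = (\<Sum>t\<in>fls.interlacing R l k. fls_X ^ (\<Sum>j<R. l j - t j) * S t)"
    \<comment> \<open>Row \<open>i\<close> corresponds to index \<open>R - i\<close>, so horizontal
      strips become interlacing sequences.\<close>
    proof (rule sum.reindex_bij_witness[where i = "\<lambda>t. \<lambda>i\<in>{1..R}. part t i"
          and j = "\<lambda>nu. \<lambda>j\<in>{0..<R}. nu (R - j) + j"])
      fix nu assume nu: "nu \<in> ?H"
      let ?t = "\<lambda>j\<in>{0..<R}. nu (R - j) + j"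
      have part_t: "part ?t i = nu i" if "i \<in> {1..R}" for i
        using that by (simp add: part_def)
      show "(\<lambda>i\<in>{1..R}. part ?t i) = nu"
      proof (rule extensionalityI[of _ "{1..R}"])
        show "nu \<in> extensional {1..R}" using nu by (simp add: horizontal_strips_def)
      qed (use part_t in auto)
      show "?t \<in> fls.interlacing R l k"
        unfolding fls.interlacing_def
      proof (intro CollectI conjI allI impI)
        fix j assume j: "j < R"
        have "part k (R - j) \<le> nu (R - j)" "nu (R - j) \<le> lam (R - j)"
          using nu j by (auto simp: horizontal_strips_def)
        then show "k j \<le> ?t j" "?t j \<le> l j" using j ge[of j] by (auto simp: part_def l_def)
        assume j': "Suc j < R"
        have "Suc (R - Suc j) = R - j" using j' by simp
        moreover have "R - Suc j \<in> {1..R}" "Suc (R - Suc j) \<le> R" using j' by auto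
        ultimately have "nu (R - j) \<le> part k (R - Suc j)"
          using nu unfolding horizontal_strips_def by fastforce
        then show "?t j < k (Suc j)" using j j' ge[of "Suc j"] by (simp add: part_def)
      qed simp
      have "(\<Sum>j<R. l j - ?t j) = (\<Sum>i = 1..R. lam i - nu i)"
        by (rule sum.reindex_bij_witness[where i = "\<lambda>i. R - i" and j = "\<lambda>j. R - j"]) (auto simp: l_def)
      moreover have "row_skew R lam (part ?t) = row_skew R lam nu"
        by (rule row_skew_cong) (rule part_t)
      ultimately show "fls_X ^ (\<Sum>j<R. l j - ?t j) * S ?t =
         fls_X ^ (\<Sum>i = 1..R. lam i - nu i) * fps_to_fls (SSYT_gf (row_skew R lam nu))"
        by (simp only: S_def)
    next
      fix t assume t: "t \<in> fls.interlacing R l k"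
      have tD: "k j \<le> t j" "t j \<le> l j" "Suc j < R \<Longrightarrow> t j < k (Suc j)" if "j < R" for j
        using t that by (auto simp: fls.interlacing_def)
      let ?nu = "\<lambda>i\<in>{1..R}. part t i"
      show "(\<lambda>j\<in>{0..<R}. ?nu (R - j) + j) = t"
      proof (rule extensionalityI[of _ "{0..<R}"])
        show "t \<in> extensional {0..<R}" using t by (simp add: fls.interlacing_def)
        show "(\<lambda>j\<in>{0..<R}. ?nu (R - j) + j) j = t j" if "j \<in> {0..<R}" for j
          using that ge[of j] tD(1)[of j] by (simp add: part_def Suc_le_eq)
      qed simp
      show "?nu \<in> ?H"
        unfolding horizontal_strips_def
      proof (intro CollectI conjI ballI impI)
        fix i assume i: "i \<in> {1..R}"
        then show "part k i \<le> ?nu i" "?nu i \<le> lam i"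
          using tD[of "R - i"] by (auto simp: part_def l_def)
        assume i': "Suc i \<le> R"
        have "Suc (R - Suc i) = R - i" using i' by simp
        then have "t (R - Suc i) < k (R - i)" using tD(3)[of "R - Suc i"] i i' by simp
        then show "?nu (Suc i) \<le> part k i" using i i' by (simp add: part_def)
      qed simp
    qed
    finally show "S k = (\<Sum>t\<in>fls.interlacing R l k. fls_X ^ (\<Sum>j<R. l j - t j) * S t)" .
  next
    show "k0 j < k0 (Suc j)" if "Suc j < R" for j
    proof -
      have "mu (R - j) \<le> mu (R - Suc j)" using that by (intro mu) auto
      then show ?thesis using that by (simp add: k0_def)
    qed
    show "k0 j \<le> l j" if "j < R" for j
      using mu_lam[of "R - j"] that by (simp add: k0_def l_def)
    show "k0 \<in> extensional {0..<R}" unfolding k0_def by (rule restrict_extensional)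
  qed (rule l_less)
  moreover have "row_skew R lam (part k0) = row_skew R lam mu"
    by (rule row_skew_cong) (simp add: part_def k0_def)
  moreover have "fls.jacobi_trudi R l k0 = fls.jacobi_trudi R (\<lambda>j. lam (R - j) + j) (\<lambda>j. mu (R - j) + j)"
    unfolding fls.jacobi_trudi_def by (rule Det_cong) (simp add: k0_def l_def)
  ultimately show ?thesis by (simp add: S_def)
qed

section \<open>The lowest term of the generating function\<close>

lemma skew_schur_ps_eq_SSYT_gf:
  "finite (skew_diagram lam mu) \<Longrightarrow> skew_schur_ps lam mu = SSYT_gf (skew_diagram lam mu)"
  unfolding skew_schur_ps_def SSYT_gf_def by (rule infsumI) (rule has_sum_SSYT)

text \<open>Column by column, the entries of a tableau are at least \<open>1, 2, 3, \<dots>\<close>, and equality is attained.\<close>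

lemma SSYT_gf_subdegree:
  fixes top bot :: "nat \<Rightarrow> nat"
  assumes S: "S = {(i, j). 1 \<le> j \<and> top j < i \<and> i \<le> bot j}" and fin: "finite S"
    and top: "\<And>j j'. 1 \<le> j \<Longrightarrow> j \<le> j' \<Longrightarrow> top j' \<le> top j"
    and N: "N = (\<Sum>(i, j)\<in>S. bot j - i)"
  shows "fps_nth (SSYT_gf S) N > 0" and "\<And>n. n < N \<Longrightarrow> fps_nth (SSYT_gf S) n = 0"
proof -
  let ?w = "\<lambda>T. \<Sum>u\<in>S. T u - (1::nat)"
  \<comment> \<open>The minimal tableau; since \<open>top\<close> is weakly decreasing, its rows
    increase weakly.\<close>
  define T0 where "T0 = (\<lambda>(i, j)\<in>S. i - top j)"
  have "T0 \<in> SSYT S"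
  proof (rule SSYT_I)
    show "T0 (i, j) \<le> T0 (i, j')" if "(i, j) \<in> S" "(i, j') \<in> S" "j < j'" for i j j'
      using that top[of j j'] by (auto simp: T0_def S)
  qed (auto simp: T0_def S)
  moreover have w0: "?w T0 = N"
    unfolding N
    \<comment> \<open>Reversing each column exchanges \<open>i - top j - 1\<close> with
      \<open>bot j - i\<close>.\<close>
    by (rule sum.reindex_bij_witness[where i = "\<lambda>(i, j). (Suc (bot j + top j) - i, j)"
          and j = "\<lambda>(i, j). (Suc (bot j + top j) - i, j)"]) (auto simp: T0_def S)
  ultimately have "{T \<in> SSYT S. ?w T = N} \<noteq> {}" by blast
  then have "card {T \<in> SSYT S. ?w T = N} > 0"
    using finite_SSYT_weight[OF fin] by (simp add: card_gt_0_iff)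
  then show "fps_nth (SSYT_gf S) N > 0" by (simp add: SSYT_gf_def)
  fix n assume n: "n < N"
  have "{T \<in> SSYT S. ?w T = n} = {}"
  proof (rule ccontr)
    assume "{T \<in> SSYT S. ?w T = n} \<noteq> {}"
    then obtain T where T: "T \<in> SSYT S" "?w T = n" by blast
    have ge: "i - top j \<le> T (i, j)" if "(i, j) \<in> S" for i j
      using that
    proof (induction i)
      case (Suc i)
      show ?case
      proof (cases "i = top j")
        case True
        then show ?thesis using SSYT_D(1)[OF T(1) Suc.prems] by simp
      next
        case False
        then have "(i, j) \<in> S" using Suc.prems by (auto simp: S)
        then show ?thesis
          using Suc.IH SSYT_D(3)[OF T(1) _ Suc.prems, of i] by simp
      qed
    qed (simp add: S)
    have "?w T0 \<le> ?w T"
    proof (rule sum_mono)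
      fix u assume u: "u \<in> S"
      obtain i j where ij: "u = (i, j)" by (cases u)
      then show "T0 u - 1 \<le> T u - 1" using u ge[of i j] by (simp add: T0_def diff_le_mono)
    qed
    with T(2) w0 n show False by simp
  qed
  then show "fps_nth (SSYT_gf S) n = 0"
    by (simp only: SSYT_gf_def fps_nth_Abs_fps card.empty of_nat_0)
qed

text \<open>As \<open>g\<close> starts with \<open>1\<close>, the connecting unit is the lowest term
  of \<open>f\<close>; it sits at degree \<open>N\<close> and has a positive coefficient, which
  leaves only \<open>fps_X ^ N\<close>.\<close>

lemma fps_eq_of_assoc:
  fixes f g :: "rat fps"
  assumes "fls.assoc (fps_to_fls f) (fps_to_fls g)" and g: "fps_nth g 0 = 1"
    and f: "fps_nth f N > 0" "\<And>n. n < N \<Longrightarrow> fps_nth f n = 0"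
  shows "f = fps_X ^ N * g"
proof -
  obtain k :: int and s where s: "s = 1 \<or> s = -1"
    and eq: "fps_to_fls f = fls_const s * fls_X_intpow k * fps_to_fls g"
  proof -
    from assms(1) obtain u where u: "fls.signed_power u" "fps_to_fls f = u * fps_to_fls g"
      by (auto simp: fls.assoc_def)
    then obtain k :: int where "u = fls_X powi k \<or> u = - (fls_X powi k)"
      by (auto simp: fls.signed_power_def)
    then have "u = fls_const 1 * fls_X_intpow k \<or> u = fls_const (-1) * fls_X_intpow k"
      by (auto simp: fls_X_power_int)
    then obtain s where "s = 1 \<or> s = -1" "u = fls_const s * fls_X_intpow k" by blast
    with u(2) show ?thesis by (intro that[of s k]) (simp_all only:)
  qed
  have nth: "fls_nth (fps_to_fls f) n = s * (fls_nth (fps_to_fls g) (n - k))" for n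
    by (simp only: eq mult.assoc fls_X_intpow_times_conv_shift(1) fls_mult_const_nth fls_shift_nth) simp
  have k: "k = int N"
  proof (rule antisym)
    have "fls_nth (fps_to_fls f) (int N) \<noteq> 0" using f(1) by simp
    then have "fls_nth (fps_to_fls g) (int N - k) \<noteq> 0" using nth[of "int N"] by auto
    then show "k \<le> int N" by (rule_tac ccontr) simp
    have "fls_nth (fps_to_fls f) k \<noteq> 0" using nth[of k] s g by auto
    then have "k \<ge> 0" "fps_nth f (nat k) \<noteq> 0" by (auto split: if_splits)
    then show "int N \<le> k" using f(2)[of "nat k"] by linarith
  qed
  have "s = 1" using nth[of "int N"] f(1) g s by (auto simp: k)
  show ?thesis
  proof (rule fps_ext)
    fix n
    show "fps_nth f n = fps_nth (fps_X ^ N * g) n"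
      using nth[of "int n"] \<open>s = 1\<close> by (auto simp: k fps_X_power_mult_nth nat_diff_distrib)
  qed
qed

section \<open>Hook lengths\<close>

text \<open>Parts decrease weakly, so the rows reaching column \<open>j\<close> form an initial
  segment, whose length is the conjugate part.\<close>

lemma conjugate_iff:
  assumes part: "is_partition lam" and "1 \<le> i" "1 \<le> j"
  shows "j \<le> lam i \<longleftrightarrow> i \<le> conjugate lam j"
proof -
  let ?A = "{i. 1 \<le> i \<and> j \<le> lam i}"
  have fin: "finite ?A"
    by (rule finite_subset[of _ "{i. 1 \<le> i \<and> lam i \<noteq> 0}"]) (use assms in \<open>auto simp: is_partition_def\<close>)
  have "?A = {1..conjugate lam j}"
  proof (cases "?A = {}")
    case True
    show ?thesis unfolding conjugate_def True by simp
  next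
    case False
    have "?A = {1..Max ?A}"
    proof (intro equalityI subsetI)
      fix r assume "r \<in> {1..Max ?A}"
      moreover have "j \<le> lam (Max ?A)" using Max_in[OF fin False] by simp
      moreover have "lam (Max ?A) \<le> lam r"
        using calculation(1) part unfolding is_partition_def by simp
      ultimately show "r \<in> ?A" by simp
    qed (use fin in auto)
    then show ?thesis by (metis card_atLeastAtMost conjugate_def diff_Suc_1)
  qed
  then show ?thesis using assms by (auto simp: set_eq_iff)
qed

lemma conjugate_antimono:
  assumes "is_partition lam" "1 \<le> j" "j \<le> j'"
  shows "conjugate lam j' \<le> conjugate lam j"
proof (cases "conjugate lam j' = 0")
  case False
  then have "j' \<le> lam (conjugate lam j')"
    using conjugate_iff[of lam "conjugate lam j'" j'] assms by simp
  then show ?thesis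
    using conjugate_iff[of lam "conjugate lam j'" j] assms False by simp
qed simp

lemma conjugate_le:
  assumes "is_partition lam" "\<forall>i>R. lam i = 0" "1 \<le> j"
  shows "conjugate lam j \<le> R"
proof (rule ccontr)
  assume "\<not> conjugate lam j \<le> R"
  then have "j \<le> lam (conjugate lam j)"
    using conjugate_iff[of lam "conjugate lam j" j] assms by simp
  with assms(2) \<open>\<not> conjugate lam j \<le> R\<close> \<open>1 \<le> j\<close> show False by simp
qed

text \<open>The numbers \<open>lam i + R - i\<close> and \<open>R + j - 1 - lam' j\<close> label the vertical and the horizontal
  steps of the boundary of \<open>lam\<close>, so together they exhaust an initial segment of the naturals.\<close>

lemma prod_boundary_labels:
  fixes f :: "nat \<Rightarrow> 'a::comm_monoid_mult"
  assumes part: "is_partition lam" and R: "\<forall>i>R. lam i = 0" and s: "s \<le> R"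
    and J: "\<And>j. 1 \<le> j \<Longrightarrow> j \<le> J \<Longrightarrow> s \<le> conjugate lam j" "\<And>i. s < i \<Longrightarrow> i \<le> R \<Longrightarrow> lam i \<le> J"
  shows "(\<Prod>t<J + (R - s). f t) =
    (\<Prod>i<R - s. f (lam (R - i) + i)) * (\<Prod>j = 1..J. f (R + j - Suc (conjugate lam j)))"
proof -
  let ?l = "\<lambda>i. lam (R - i) + i" and ?y = "\<lambda>j. R + j - Suc (conjugate lam j)"
  have le: "conjugate lam j \<le> R" if "1 \<le> j" for j by (rule conjugate_le[OF part R that])
  have "?l i < ?l i'" if "i < i'" "i' < R" for i i'
  proof -
    have "lam (R - i) \<le> lam (R - i')" using part that unfolding is_partition_def by auto
    then show ?thesis using that by simp
  qed
  then have injl: "inj_on ?l {..<R - s}"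
    by (intro linorder_inj_onI') (metis lessThan_iff less_diff_conv less_irrefl add_lessD1)
  have "?y j < ?y j'" if "1 \<le> j" "j < j'" for j j'
    using conjugate_antimono[OF part that(1), of j'] le[of j] that by simp
  then have injy: "inj_on ?y {1..J}"
    by (intro linorder_inj_onI') (metis atLeastAtMost_iff less_irrefl)
  have disj: "?l ` {..<R - s} \<inter> ?y ` {1..J} = {}"
  proof -
    have "?l i \<noteq> ?y j" if "i < R - s" "1 \<le> j" for i j
    proof -
      \<comment> \<open>According to whether the cell lies in the diagram, the row label is strictly
        larger or strictly smaller than the column label.\<close>
      have "j \<le> lam (R - i) \<longleftrightarrow> R - i \<le> conjugate lam j"
        using that by (intro conjugate_iff[OF part]) auto
      then show ?thesis using le[OF that(2)] that by linarith
    qed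
    then show ?thesis by auto
  qed
  have "?l ` {..<R - s} \<union> ?y ` {1..J} \<subseteq> {..<J + (R - s)}"
  proof -
    have "?l i < J + (R - s)" if "i < R - s" for i
    proof -
      have "lam (R - i) \<le> J" using that by (intro J(2)) auto
      then show ?thesis using that by simp
    qed
    moreover have "?y j < J + (R - s)" if "1 \<le> j" "j \<le> J" for j
      using J(1)[OF that] le[of j] that s by simp
    ultimately show ?thesis by auto
  qed
  moreover have "card (?l ` {..<R - s} \<union> ?y ` {1..J}) = J + (R - s)"
    using disj injl injy by (simp add: card_Un_disjoint card_image)
  \<comment> \<open>Distinct labels, as many as the segment has elements and all inside it, must
    fill it.\<close>
  ultimately have "?l ` {..<R - s} \<union> ?y ` {1..J} = {..<J + (R - s)}"
    by (intro card_subset_eq) auto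
  then have "(\<Prod>t<J + (R - s). f t) = (\<Prod>t\<in>?l ` {..<R - s} \<union> ?y ` {1..J}. f t)" by simp
  also have "\<dots> = (\<Prod>t\<in>?l ` {..<R - s}. f t) * (\<Prod>t\<in>?y ` {1..J}. f t)"
    by (rule prod.union_disjoint) (use disj in auto)
  finally show ?thesis by (simp only: prod.reindex[OF injl] prod.reindex[OF injy] comp_def)
qed

text \<open>The hook of a cell spans the boundary between the vertical step of its row and the
  horizontal step of its column; on cells the natural subtraction is exact.\<close>

lemma hook_length_boundary_labels:
  assumes part: "is_partition lam" and R: "\<forall>i>R. lam i = 0" and "i \<in> {1..R}" "1 \<le> j" "j \<le> lam i"
  shows "hook_length lam i j = lam i + (R - i) - (R + j - Suc (conjugate lam j))"
    and "hook_length lam i j > 0"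
  using conjugate_iff[OF part, of i j] conjugate_le[OF part R \<open>1 \<le> j\<close>] assms
  by (auto simp: hook_length_def)

lemma diagram_eq_Sigma:
  assumes "\<forall>i>R. lam i = 0"
  shows "diagram lam = Sigma {1..R} (\<lambda>i. {1..lam i})"
  using assms by (force simp: diagram_def not_less[symmetric])

context qfield
begin

lemma qfact_reverse: "qfact n = (\<Prod>t<n. 1 - q ^ (n - t))"
  unfolding qfact_def
  by (rule prod.reindex_bij_witness[where i = "\<lambda>t. n - t" and j = "\<lambda>k. n - k"]) auto

text \<open>Row by row, \<open>qfact\<close> of a label is the product of
  \<open>1 - q ^ (label - t)\<close> over all smaller \<open>t\<close>. Such \<open>t\<close> are
  labels of lower rows, which cancel the Vandermonde factors, or of columns meeting the row, which
  give its hooks.\<close>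

lemma hook_product_assoc:
  assumes part: "is_partition lam" and R: "\<forall>i>R. lam i = 0"
  shows "(\<Prod>i<R. 1 / qfact (lam (R - i) + i)) * Vandermonde R (\<lambda>i. q ^ (lam (R - i) + i)) \<approx>\<^sub>q
    (\<Prod>(i, j)\<in>diagram lam. 1 / (1 - q ^ hook_length lam i j))"
proof -
  let ?l = "\<lambda>i. lam (R - i) + i"
  have less: "?l i < ?l i'" if "i < i'" "i' < R" for i i'
  proof -
    have "lam (R - i) \<le> lam (R - i')" using part that unfolding is_partition_def by auto
    then show ?thesis using that by simp
  qed
  have "(\<Prod>i<R. 1 / qfact (?l i)) * Vandermonde R (\<lambda>i. q ^ ?l i) =
      (\<Prod>i<R. 1 / qfact (?l i) * (\<Prod>k<i. q ^ ?l i - q ^ ?l k))"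
    by (simp only: Vandermonde_eq prod.distrib)
  also have "\<dots> \<approx>\<^sub>q (\<Prod>i<R. \<Prod>j = 1..lam (R - i). 1 / (1 - q ^ hook_length lam (R - i) j))"
  proof (rule assoc_prod)
    fix i assume "i \<in> {..<R}"
    then have i: "i < R" "R - (R - i) = i" "R - i \<in> {1..R}" by auto
    let ?V = "\<Prod>k<i. 1 - q ^ (?l i - ?l k)"
    have V: "(\<Prod>k<i. q ^ ?l i - q ^ ?l k) \<approx>\<^sub>q ?V"
      by (intro assoc_prod power_diff_assoc less_imp_le less) (use i in auto)
    have "qfact (?l i) = ?V * (\<Prod>j = 1..lam (R - i). 1 - q ^ (?l i - (R + j - Suc (conjugate lam j))))"
    proof -
      have "lam r \<le> lam (R - i)" if "R - i < r" for r
        using part that i(3) unfolding is_partition_def by auto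
      moreover have "R - i \<le> conjugate lam j" if "1 \<le> j" "j \<le> lam (R - i)" for j
        using conjugate_iff[OF part, of "R - i" j] that i by auto
      \<comment> \<open>With \<open>s = R - i\<close> and \<open>J = lam (R - i)\<close> the segment
        length \<open>J + (R - s)\<close> is the label \<open>?l i\<close>.\<close>
      ultimately show ?thesis
        unfolding qfact_reverse
        using prod_boundary_labels[OF part R, where s = "R - i" and J = "lam (R - i)"
          and f = "\<lambda>t. 1 - q ^ (?l i - t)"] i by simp
    qed
    also have "(\<Prod>j = 1..lam (R - i). 1 - q ^ (?l i - (R + j - Suc (conjugate lam j)))) =
        (\<Prod>j = 1..lam (R - i). 1 - q ^ hook_length lam (R - i) j)"
      using hook_length_boundary_labels(1)[OF part R, of "R - i"] i by (intro prod.cong) auto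
    finally have qf: "qfact (?l i) = ?V * (\<Prod>j = 1..lam (R - i). 1 - q ^ hook_length lam (R - i) j)" .
    then have "?V \<noteq> 0" using qfact_nonzero[of "?l i"] by auto
    have "1 / qfact (?l i) * (\<Prod>k<i. q ^ ?l i - q ^ ?l k) \<approx>\<^sub>q 1 / qfact (?l i) * ?V"
      by (intro assoc_mult assoc_refl V)
    also have "\<dots> = (\<Prod>j = 1..lam (R - i). 1 / (1 - q ^ hook_length lam (R - i) j))"
      unfolding qf using \<open>?V \<noteq> 0\<close> by (simp add: prod_dividef)
    finally show "1 / qfact (?l i) * (\<Prod>k<i. q ^ ?l i - q ^ ?l k) \<approx>\<^sub>q
      (\<Prod>j = 1..lam (R - i). 1 / (1 - q ^ hook_length lam (R - i) j))" .
  qed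
  also have "\<dots> = (\<Prod>i = 1..R. \<Prod>j = 1..lam i. 1 / (1 - q ^ hook_length lam i j))"
    by (rule prod.reindex_bij_witness[where i = "\<lambda>i. R - i" and j = "\<lambda>i. R - i"]) auto
  also have "\<dots> = (\<Prod>(i, j)\<in>diagram lam. 1 / (1 - q ^ hook_length lam i j))"
    unfolding diagram_eq_Sigma[OF R] by (subst prod.Sigma) auto
  finally show ?thesis .
qed

end

section \<open>Rows, columns and hooks of the shape\<close>

lemma Lambda_outer_upper:
  assumes "1 \<le> i" "i \<le> a + c"
  shows "Lambda_outer a b c d e m i = b + c + d + (a + c - i) * m"
proof -
  have "{1..Lambda_outer a b c d e m i} = {1..b + c + d + (a + c - i) * m}"
    unfolding Lambda_cells_row[symmetric] using assms by (auto simp: Lambda_cells_def Lambda_nu_def)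
  from arg_cong[OF this, of card] show ?thesis by simp
qed

lemma mem_Lambda_cells: "1 \<le> i \<Longrightarrow> 1 \<le> j \<Longrightarrow> (i, j) \<in> Lambda_cells a b c d e m \<longleftrightarrow> j \<le> Lambda_outer a b c d e m i"
  using Lambda_cells_row[of i a b c d e m] by (auto simp: set_eq_iff)

lemma Lambda_outer_lower:
  assumes "a + c < i"
  shows "Lambda_outer a b c d e m i \<le> b + c"
    and "a + c + e + (b + c) * m < i \<Longrightarrow> Lambda_outer a b c d e m i = 0"
proof -
  let ?j = "Lambda_outer a b c d e m i"
  have *: "?j \<le> b + c \<and> i \<le> a + c + e + (b + c - ?j) * m" if "?j > 0"
    using mem_Lambda_cells[of i ?j a b c d e m] assms that
    by (auto simp: Lambda_cells_def Lambda_theta_def)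
  then show "?j \<le> b + c" by (cases "?j > 0") auto
  have "(b + c - ?j) * m \<le> (b + c) * m" by (simp add: mult_le_mono1)
  then show "?j = 0" if "a + c + e + (b + c) * m < i" using * that by (cases "?j > 0") linarith+
qed

lemma conjugate_Lambda_outer:
  assumes "1 \<le> j" "j \<le> b + c"
  shows "conjugate (Lambda_outer a b c d e m) j = a + c + e + (b + c - j) * m"
proof -
  have "{i. 1 \<le> i \<and> j \<le> Lambda_outer a b c d e m i} = {i. 1 \<le> i \<and> (i, j) \<in> Lambda_cells a b c d e m}"
    using mem_Lambda_cells assms by blast
  also have "\<dots> = {1..a + c + e + (b + c - j) * m}"
    using assms by (auto simp: Lambda_cells_def Lambda_theta_def)
  finally show ?thesis by (simp add: conjugate_def)
qed

text \<open>Inside the rectangle with \<open>a + c\<close> rows and \<open>b + c\<close> columns, a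
  step up or left lengthens the hook by \<open>1\<close> within the rectangle and by
  \<open>m\<close> in the staircase beyond it. This is the source of the base
  \<open>p\<close>.\<close>

lemma hook_length_Lambda_outer:
  assumes "1 \<le> i" "i \<le> a + c" "1 \<le> j" "j \<le> b + c"
  shows "hook_length (Lambda_outer a b c d e m) i j = d + e + 1 + Suc m * ((a + c - i) + (b + c - j))"
proof -
  obtain r s where rs: "a + c = i + r" "b + c = j + s" using assms by (metis le_add_diff_inverse)
  have "hook_length (Lambda_outer a b c d e m) i j = nat (int (d + e + 1 + Suc m * (r + s)))"
    unfolding hook_length_def Lambda_outer_upper[OF assms(1,2)] conjugate_Lambda_outer[OF assms(3,4)] rs
    by (rule arg_cong[of _ _ nat]) (simp add: algebra_simps)
  then show ?thesis unfolding nat_int rs by simp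
qed

lemma Vandermonde_add:
  fixes x :: "nat \<Rightarrow> 'a::idom"
  shows "Vandermonde (r + n) x =
    Vandermonde r x * (\<Prod>i<n. \<Prod>k<r. x (r + i) - x k) * Vandermonde n (\<lambda>i. x (r + i))"
  unfolding Vandermonde_eq prod_lessThan_add prod.distrib by (simp only: mult.assoc)

context qfield_step
begin

text \<open>On the left, rows are counted upwards from \<open>a + c\<close> and columns leftwards
  from \<open>b\<close>. These factors cancel the removed block from the full hook product.\<close>

lemma prod_psi_eq_hooks:
  "(\<Prod>i<a. psi b (p ^ c * q ^ (d + e + 1) * p ^ i)) =
    (\<Prod>(i, j)\<in>{c + 1..c + a} \<times> {1..b}. 1 - q ^ hook_length (Lambda_outer a b c d e m) i j)"
proof -
  let ?g = "\<lambda>x. 1 - q ^ (d + e + 1 + Suc m * (c + x))"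
  have "psi b (p ^ c * q ^ (d + e + 1) * p ^ i) = (\<Prod>s<b. ?g (i + s))" for i
    unfolding psi_def p_power by (simp add: algebra_simps flip: power_add)
  then have "(\<Prod>i<a. psi b (p ^ c * q ^ (d + e + 1) * p ^ i)) = (\<Prod>i<a. \<Prod>s<b. ?g (i + s))"
    by simp
  also have "\<dots> = (\<Prod>i = c + 1..c + a. \<Prod>s<b. ?g (a + c - i + s))"
    by (rule prod.reindex_bij_witness[where i = "\<lambda>i. a + c - i" and j = "\<lambda>i. a + c - i"]) auto
  also have "\<dots> = (\<Prod>i = c + 1..c + a. \<Prod>j = 1..b. 1 - q ^ hook_length (Lambda_outer a b c d e m) i j)"
  proof (rule prod.cong[OF refl])
    fix i assume i: "i \<in> {c + 1..c + a}"
    have "(\<Prod>s<b. ?g (a + c - i + s)) = (\<Prod>j = 1..b. ?g (a + c - i + (b - j)))"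
      by (rule prod.reindex_bij_witness[where i = "\<lambda>j. b - j" and j = "\<lambda>s. b - s"]) auto
    also have "\<dots> = (\<Prod>j = 1..b. 1 - q ^ hook_length (Lambda_outer a b c d e m) i j)"
    proof (rule prod.cong[OF refl])
      fix j assume j: "j \<in> {1..b}"
      have "c + (a + c - i + (b - j)) = (a + c - i) + (b + c - j)" using j by auto
      moreover have "hook_length (Lambda_outer a b c d e m) i j =
          d + e + 1 + Suc m * ((a + c - i) + (b + c - j))"
        using i j by (intro hook_length_Lambda_outer) auto
      ultimately show "?g (a + c - i + (b - j)) = 1 - q ^ hook_length (Lambda_outer a b c d e m) i j"
        by (simp only:)
    qed
    finally show "(\<Prod>s<b. ?g (a + c - i + s)) =
      (\<Prod>j = 1..b. 1 - q ^ hook_length (Lambda_outer a b c d e m) i j)" .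
  qed
  finally show ?thesis by (simp only: prod.cartesian_product)
qed

text \<open>For fixed \<open>i\<close> and \<open>k\<close> the product over \<open>j\<close>
  telescopes.\<close>

lemma box_eq:
  "box b c = (\<Prod>i = 1..a. \<Prod>j = 1..b. \<Prod>k = 1..c.
     (1 - q ^ ((m + 1) * (i + j + k - 1))) / (1 - q ^ ((m + 1) * (i + j + k - 2))))"
proof -
  let ?f = "\<lambda>i j k. (1 - p ^ (i + j + k + 2)) / (1 - p ^ (i + j + k + 1))"
  have tele: "(\<Prod>j<b. ?f i j k) = (1 - p ^ (b + k + Suc i)) / (1 - p ^ (k + Suc i))" for i k
  proof (induction b)
    case 0
    then show ?case using p_power_neq_1[of "k + Suc i"] by simp
  next
    case (Suc b)
    have "1 - p ^ (b + k + Suc i) \<noteq> 0" by (rule p_power_neq_1) simp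
    moreover have "i + b + k + 1 = b + k + Suc i" "i + b + k + 2 = Suc b + k + Suc i" by auto
    ultimately show ?case unfolding prod.lessThan_Suc Suc by (simp only:) simp
  qed
  have "(\<Prod>i = 1..a. \<Prod>j = 1..b. \<Prod>k = 1..c.
     (1 - q ^ ((m + 1) * (i + j + k - 1))) / (1 - q ^ ((m + 1) * (i + j + k - 2)))) =
    (\<Prod>i<a. \<Prod>j<b. \<Prod>k<c. ?f i j k)"
    unfolding One_nat_def prod.atLeast1_atMost_eq p_power by (simp add: numeral_2_eq_2)
  also have "\<dots> = (\<Prod>i<a. \<Prod>k<c. \<Prod>j<b. ?f i j k)"
    by (intro prod.cong refl prod.swap)
  also have "\<dots> = (\<Prod>k<c. \<Prod>i<a. \<Prod>j<b. ?f i j k)"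
    by (rule prod.swap)
  finally show ?thesis unfolding tele box_def by simp
qed

lemma Lambda_jacobi_trudi_assoc:
  fixes b c d e :: nat
  defines "lam \<equiv> Lambda_outer a b c d e m" and "R \<equiv> a + c + e + (b + c) * m"
  shows "jacobi_trudi R (\<lambda>j. lam (R - j) + j) (\<lambda>j. rect b a (R - j) + j) \<approx>\<^sub>q
    box b c * (\<Prod>(i, j)\<in>diagram lam - {c + 1..c + a} \<times> {1..b}. 1 / (1 - q ^ hook_length lam i j))"
proof -
  \<comment> \<open>The number of rows below the first \<open>a + c\<close>, empty ones up to
    \<open>R\<close> included.\<close>
  define r0 where "r0 = e + (b + c) * m"
  have R: "R = r0 + c + a" "R = r0 + (c + a)" by (simp_all add: R_def r0_def)
  have part: "is_partition lam" unfolding lam_def by (rule is_partition_Lambda_outer)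
  have lamR: "\<forall>i>R. lam i = 0"
    unfolding lam_def by (auto intro!: Lambda_outer_lower(2) simp: R_def)
  define l where "l j = lam (R - j) + j" for j
  define x where "x j = q ^ l j" for j
  define y where "y j = R + j - Suc (conjugate lam j)" for j
  define Q where "Q Y = (\<Prod>j = 1..b + c. Y - q ^ y j)" for Y
  \<comment> \<open>For positive \<open>a + c\<close> and \<open>b + c\<close> the exponent of
    \<open>zeta\<close> is the hook length at \<open>(a + c, b + c)\<close>, and that of
    \<open>U\<close> is the label of row \<open>a + c\<close>.\<close>
  define zeta where "zeta = q ^ (d + e + 1)"
  define U where "U = q ^ (b + c + d + r0)"
  define C where "C = (\<Prod>j = 1..b + c. - (q ^ y j))"
  let ?hooks = "\<Prod>(i, j)\<in>diagram lam. 1 / (1 - q ^ hook_length lam i j)"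
  let ?psis = "\<Prod>i<a. psi b (p ^ c * zeta * p ^ i)"
  have units: "signed_power zeta" "signed_power U" "signed_power C"
    unfolding zeta_def U_def C_def by (intro signed_power_intros)+
  have x_upper: "x (r0 + i) = U * p ^ i" if "i < c + a" for i
  proof -
    have "R - (r0 + i) = a + c - i" "a + c - (a + c - i) = i" using that R by auto
    then have "l (r0 + i) = b + c + d + r0 + Suc m * i"
      unfolding l_def lam_def using that by (simp add: Lambda_outer_upper)
    then show ?thesis by (simp add: x_def U_def p_power power_add)
  qed
  \<comment> \<open>The choice of \<open>R\<close> makes the label of column \<open>j\<close> equal
    to \<open>(m + 1) j - 1\<close>, so the roots of \<open>Q\<close> are geometric with ratio
    \<open>p\<close>.\<close>
  have y_eq: "y j + 1 = Suc m * j" if j: "j \<in> {1..b + c}" for j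
  proof -
    obtain s where s: "b + c = j + s" using j le_Suc_ex[of j "b + c"] by auto
    have "conjugate lam j = a + c + e + (b + c - j) * m"
      unfolding lam_def by (rule conjugate_Lambda_outer) (use that in auto)
    then show ?thesis using that unfolding y_def R_def s by (simp add: algebra_simps)
  qed
  have Q_eq: "Q (x (r0 + i)) = C * psi (b + c) (zeta * p ^ i)" if "i < c + a" for i
  proof -
    have "psi (b + c) (zeta * p ^ i) = (\<Prod>j = 1..b + c. 1 - zeta * p ^ i * p ^ (b + c - j))"
      unfolding psi_def
      by (rule prod.reindex_bij_witness[where i = "\<lambda>j. b + c - j" and j = "\<lambda>s. b + c - s"]) auto
    moreover have "x (r0 + i) - q ^ y j = - (q ^ y j) * (1 - zeta * p ^ i * p ^ (b + c - j))"
      if j: "j \<in> {1..b + c}" for j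
    proof -
      obtain s where s: "b + c = j + s" using j le_Suc_ex[of j "b + c"] by auto
      have "b + c + d + r0 = (y j + 1) + d + e + Suc m * (b + c - j)"
        unfolding y_eq[OF j] r0_def s by (simp add: algebra_simps)
      then have "b + c + d + r0 + Suc m * i = y j + (d + e + 1 + Suc m * i + Suc m * (b + c - j))" by simp
      then have "U * p ^ i = q ^ y j * (zeta * p ^ i * p ^ (b + c - j))"
        by (simp only: U_def zeta_def p_power power_add[symmetric])
      then show ?thesis using x_upper[OF \<open>i < c + a\<close>] by (simp add: algebra_simps)
    qed
    ultimately show ?thesis unfolding Q_def C_def by (simp only: prod.distrib[symmetric] cong: prod.cong)
  qed
  \<comment> \<open>Boundary labels for the rows below \<open>a + c\<close> and the first
    \<open>b + c\<close> columns: the roots \<open>q ^ t\<close> split into the nodes of those rows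
    and the roots of \<open>Q\<close>.\<close>
  have fact: "(\<Prod>t<r0 + c + b. Y - q ^ t) = (\<Prod>i<r0. Y - x i) * Q Y" for Y
  proof -
    have "(\<Prod>t<b + c + (R - (a + c)). Y - q ^ t) =
      (\<Prod>i<R - (a + c). Y - q ^ (lam (R - i) + i)) * (\<Prod>j = 1..b + c. Y - q ^ (R + j - Suc (conjugate lam j)))"
    proof (rule prod_boundary_labels[OF part lamR])
      show "a + c \<le> conjugate lam j" if "1 \<le> j" "j \<le> b + c" for j
        unfolding lam_def using that by (simp add: conjugate_Lambda_outer)
      show "lam i \<le> b + c" if "a + c < i" for i
        unfolding lam_def using that by (rule Lambda_outer_lower)
    qed (simp_all add: R)
    moreover have "R - (a + c) = r0" "b + c + r0 = r0 + c + b" by (auto simp: R)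
    ultimately show ?thesis by (simp only: x_def l_def Q_def y_def)
  qed
  let ?D = "Det (c + a) (\<lambda>i j. if j < c then x (r0 + i) ^ j else Q (x (r0 + i)) * x (r0 + i) ^ (j - c))"
  let ?V = "Vandermonde (c + a) (\<lambda>i. x (r0 + i))"
  have V: "?V \<approx>\<^sub>q (\<Prod>i<c + a. pfact i)"
  proof -
    have "?V = Vandermonde (c + a) (\<lambda>i. U * p ^ i)" by (rule Det_cong) (simp add: x_upper)
    then show ?thesis using Vandermonde_geometric[OF units(2)] by simp
  qed
  have D: "?D \<approx>\<^sub>q ?V * (box b c * ?psis)"
  proof -
    \<comment> \<open>Moving the first node from \<open>U\<close> to \<open>zeta\<close> rescales
      the columns by powers of \<open>U / zeta\<close>, a signed power.\<close>
    let ?c = "\<lambda>j. if j < c then (U / zeta) ^ j else C * (U / zeta) ^ (j - c)"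
    let ?E = "\<lambda>i j. if j < c then (zeta * p ^ i) ^ j else psi (b + c) (zeta * p ^ i) * (zeta * p ^ i) ^ (j - c)"
    have "?D = Det (c + a) (\<lambda>i j. 1 * ?c j * ?E i j)"
    proof (rule Det_cong)
      fix i j assume i: "i < c + a"
      have "x (r0 + i) ^ k = (U / zeta) ^ k * (zeta * p ^ i) ^ k" for k
        unfolding x_upper[OF i] power_mult_distrib[symmetric]
        using signed_power_nonzero[OF units(1)] by simp
      then show "(if j < c then x (r0 + i) ^ j else Q (x (r0 + i)) * x (r0 + i) ^ (j - c)) = 1 * ?c j * ?E i j"
        by (simp add: Q_eq[OF i] mult_ac)
    qed
    also have "\<dots> = (\<Prod>j<c + a. ?c j) * Det (c + a) ?E"
      unfolding Det_scale by simp
    also have "\<dots> \<approx>\<^sub>q Det (c + a) ?E"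
      by (rule assoc_signed_power_mult) (auto intro!: signed_power_intros units)
    also have "\<dots> \<approx>\<^sub>q (\<Prod>i<c + a. pfact i) * (box b c * ?psis)"
      by (rule box_det_assoc[OF units(1)])
    also have "\<dots> \<approx>\<^sub>q ?V * (box b c * ?psis)"
      by (intro assoc_mult assoc_refl assoc_sym[OF V])
    finally show ?thesis .
  qed
  have "jacobi_trudi R (\<lambda>j. lam (R - j) + j) (\<lambda>j. rect b a (R - j) + j) \<approx>\<^sub>q
    (\<Prod>i<R. 1 / qfact (l i)) * Det R (\<lambda>i j. \<Prod>t<rect b a (R - j) + j. q ^ l i - q ^ t)"
    unfolding l_def by (rule jacobi_trudi_assoc)
  also have "Det R (\<lambda>i j. \<Prod>t<rect b a (R - j) + j. q ^ l i - q ^ t) =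
    Det (r0 + c + a) (\<lambda>i j. \<Prod>t<(if j < r0 + c then j else j + b). x i - q ^ t)"
    unfolding R(1)
  proof (rule Det_cong)
    fix i j assume "j < r0 + c + a"
    \<comment> \<open>The row number \<open>R - j\<close> is at most \<open>a\<close> exactly for
      the last \<open>a\<close> indices.\<close>
    then have "rect b a (r0 + c + a - j) + j = (if j < r0 + c then j else j + b)"
      by (auto simp: rect_def)
    then show "(\<Prod>t<rect b a (r0 + c + a - j) + j. q ^ l i - q ^ t) =
      (\<Prod>t<(if j < r0 + c then j else j + b). x i - q ^ t)" by (simp only: x_def)
  qed
  also have "\<dots> = Vandermonde r0 x * (\<Prod>i<c + a. \<Prod>k<r0. x (r0 + i) - x k) * ?D"
    by (rule Det_factorial_powers[OF fact])
  finally have "jacobi_trudi R (\<lambda>j. lam (R - j) + j) (\<lambda>j. rect b a (R - j) + j) \<approx>\<^sub>q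
    (\<Prod>i<R. 1 / qfact (l i)) * (Vandermonde r0 x * (\<Prod>i<c + a. \<Prod>k<r0. x (r0 + i) - x k) * ?D)" .
  also have "\<dots> \<approx>\<^sub>q (\<Prod>i<R. 1 / qfact (l i)) *
      (Vandermonde r0 x * (\<Prod>i<c + a. \<Prod>k<r0. x (r0 + i) - x k) * (?V * (box b c * ?psis)))"
    by (intro assoc_mult assoc_refl D)
  \<comment> \<open>The three Vandermonde pieces reassemble into the Vandermonde determinant of all
    nodes, the one in the hook product.\<close>
  also have "\<dots> = ((\<Prod>i<R. 1 / qfact (l i)) * Vandermonde R x) * (box b c * ?psis)"
    unfolding R(2) Vandermonde_add by (simp only: mult_ac)
  also have "\<dots> \<approx>\<^sub>q ?hooks * (box b c * ?psis)"
    using hook_product_assoc[OF part lamR] by (intro assoc_mult assoc_refl) (simp add: l_def x_def)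
  also have "\<dots> = box b c * (\<Prod>(i, j)\<in>diagram lam - {c + 1..c + a} \<times> {1..b}. 1 / (1 - q ^ hook_length lam i j))"
  proof -
    let ?B = "{c + 1..c + a} \<times> {1..b}"
    have fin: "finite (diagram lam)" unfolding diagram_eq_Sigma[OF lamR] by simp
    have sub: "?B \<subseteq> diagram lam"
    proof
      fix u assume "u \<in> ?B"
      then show "u \<in> diagram lam"
        by (cases u) (auto simp: diagram_def lam_def Lambda_outer_upper)
    qed
    have "(\<Prod>(i, j)\<in>?B. 1 / (1 - q ^ hook_length lam i j)) * (\<Prod>(i, j)\<in>?B. 1 - q ^ hook_length lam i j) = 1"
      unfolding prod.distrib[symmetric]
    proof (rule prod.neutral, clarify)
      fix i j assume "i \<in> {c + 1..c + a}" "j \<in> {1..b}"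
      then have "(i, j) \<in> diagram lam" using sub by auto
      then have "hook_length lam i j > 0"
        using hook_length_boundary_labels(2)[OF part lamR] unfolding diagram_eq_Sigma[OF lamR] by auto
      then have "1 - q ^ hook_length lam i j \<noteq> 0" using q_power_neq_1 by simp
      then show "1 / (1 - q ^ hook_length lam i j) * (1 - q ^ hook_length lam i j) = 1" by simp
    qed
    moreover have "?psis = (\<Prod>(i, j)\<in>?B. 1 - q ^ hook_length lam i j)"
      unfolding zeta_def lam_def by (rule prod_psi_eq_hooks)
    moreover have "?hooks = (\<Prod>(i, j)\<in>diagram lam - ?B. 1 / (1 - q ^ hook_length lam i j)) *
        (\<Prod>(i, j)\<in>?B. 1 / (1 - q ^ hook_length lam i j))"
      by (rule prod.subset_diff[OF sub fin])
    ultimately show ?thesis by (simp only: mult_ac) simp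
  qed
  finally show ?thesis .
qed

end

section \<open>Transfer to power series and conclusion\<close>

lemma fps_to_fls_divide:
  fixes f g :: "rat fps"
  assumes "fps_nth g 0 \<noteq> 0"
  shows "fps_to_fls (f / g) = fps_to_fls f / fps_to_fls g"
proof -
  have "g \<noteq> 0" using assms by auto
  moreover have "f / g * g = f" using assms by (simp add: fps_divide_unit mult.assoc inverse_mult_eq_1)
  ultimately show ?thesis by (metis fps_to_fls_mult fps_to_fls_eq_0_iff nonzero_mult_div_cancel_right)
qed

lemma fps_prod_nth_0: "fps_nth (prod f A) 0 = (\<Prod>x\<in>A. fps_nth (f x :: rat fps) 0)"
  by (induction A rule: infinite_finite_induct) simp_all

lemma fps_to_fls_one_minus_X_power: "fps_to_fls (1 - fps_X ^ n :: rat fps) = 1 - fls_X ^ n"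
  by (simp add: fps_to_fls_power)

theorem theorem4p2:
  fixes a b c d e m N :: nat and lam mu :: "nat \<Rightarrow> nat"
  assumes "lam = Lambda_outer a b c d e m"
    and "mu = rect b a"
    and "N = (\<Sum>(i, j)\<in>skew_diagram lam mu. conjugate lam j - i)"
  shows "skew_schur_ps lam mu =
    fps_X ^ N *
    (\<Prod>i = 1..a. \<Prod>j = 1..b. \<Prod>k = 1..c.
       (1 - fps_X ^ ((m + 1) * (i + j + k - 1))) / (1 - fps_X ^ ((m + 1) * (i + j + k - 2)))) *
    (\<Prod>(i, j)\<in>diagram lam - {c + 1..c + a} \<times> {1..b}. 1 / (1 - fps_X ^ hook_length lam i j))"
proof -
  interpret qs: qfield_step "fls_X :: rat fls" m a by unfold_locales
  define R where "R = a + c + e + (b + c) * m"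
  let ?S = "skew_diagram lam mu"
  let ?B = "{c + 1..c + a} \<times> {1..b}"
  have part: "is_partition lam" unfolding assms by (rule is_partition_Lambda_outer)
  have lamR: "\<forall>i>R. lam i = 0"
    unfolding assms by (auto intro!: Lambda_outer_lower(2) simp: R_def)
  have S: "?S = row_skew R lam mu"
    unfolding skew_diagram_def diagram_eq_Sigma[OF lamR]
    by (auto simp: row_skew_def diagram_def assms(2) rect_def)
  have fin: "finite ?S" unfolding S by (rule finite_row_skew)
  let ?f = "SSYT_gf ?S"
  \<comment> \<open>The product side without its monomial; its constant term \<open>1\<close> lets
    the lowest term of the tableau side fix sign and power.\<close>
  define g :: "rat fps" where "g = (\<Prod>i = 1..a. \<Prod>j = 1..b. \<Prod>k = 1..c.
       (1 - fps_X ^ ((m + 1) * (i + j + k - 1))) / (1 - fps_X ^ ((m + 1) * (i + j + k - 2)))) *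
    (\<Prod>(i, j)\<in>diagram lam - ?B. 1 / (1 - fps_X ^ hook_length lam i j))"
  have nth0: "fps_nth (1 - fps_X ^ n :: rat fps) 0 = 1" if "n > 0" for n using that by simp
  have hook: "hook_length lam i j > 0" if "(i, j) \<in> diagram lam" for i j
    using hook_length_boundary_labels(2)[OF part lamR] that unfolding diagram_eq_Sigma[OF lamR] by auto
  have div0: "fps_nth (f / (1 - fps_X ^ n) :: rat fps) 0 = fps_nth f 0" if "n > 0" for f n
    using nth0[OF that] by (simp add: fps_divide_unit)
  have g0: "fps_nth g 0 = 1"
    unfolding g_def fps_mult_nth_0 fps_prod_nth_0
  proof -
    have "fps_nth (case u of (i, j) \<Rightarrow> 1 / (1 - (fps_X :: rat fps) ^ hook_length lam i j)) 0 = 1"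
      if "u \<in> diagram lam - ?B" for u
      using that hook by (cases u) (simp add: div0)
    moreover have "fps_nth ((1 - fps_X ^ ((m + 1) * (i + j + k - 1))) /
        (1 - fps_X ^ ((m + 1) * (i + j + k - 2))) :: rat fps) 0 = 1"
      if "i \<in> {1..a}" "j \<in> {1..b}" "k \<in> {1..c}" for i j k
      using that by (subst div0) auto
    ultimately show "(\<Prod>i = 1..a. \<Prod>j = 1..b. \<Prod>k = 1..c. fps_nth ((1 - fps_X ^ ((m + 1) * (i + j + k - 1))) /
        (1 - fps_X ^ ((m + 1) * (i + j + k - 2))) :: rat fps) 0) *
      (\<Prod>u\<in>diagram lam - ?B. fps_nth (case u of (i, j) \<Rightarrow> 1 / (1 - fps_X ^ hook_length lam i j)) 0) = 1"
      by simp
  qed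
  have "fls.assoc (fps_to_fls ?f) (fps_to_fls g)"
  proof -
    have "fps_to_fls ?f = fls.jacobi_trudi R (\<lambda>j. lam (R - j) + j) (\<lambda>j. mu (R - j) + j)"
      unfolding S
    proof (rule SSYT_gf_jacobi_trudi)
      show "lam j \<le> lam i" if "1 \<le> i" "i \<le> j" for i j
        using part that unfolding is_partition_def by blast
      show "mu j \<le> mu i" if "1 \<le> i" "i \<le> j" for i j using that by (auto simp: assms rect_def)
      show "mu i \<le> lam i" if "i \<in> {1..R}" for i
        using that by (auto simp: assms rect_def Lambda_outer_upper)
    qed
    also have "fls.assoc \<dots> (qs.box b c *
        (\<Prod>(i, j)\<in>diagram lam - ?B. 1 / (1 - fls_X ^ hook_length lam i j)))"
      unfolding assms R_def by (rule qs.Lambda_jacobi_trudi_assoc)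
    also have "\<dots> = fps_to_fls g"
    proof -
      have div: "fps_to_fls (f / (1 - fps_X ^ n) :: rat fps) = fps_to_fls f / (1 - fls_X ^ n)"
        if "n > 0" for f n
      proof -
        have "fps_nth (1 - fps_X ^ n :: rat fps) 0 \<noteq> 0" unfolding nth0[OF that] by simp
        from fps_to_fls_divide[OF this, of f] show ?thesis by (simp only: fps_to_fls_one_minus_X_power)
      qed
      have "(\<Prod>i = 1..a. \<Prod>j = 1..b. \<Prod>k = 1..c.
         fps_to_fls ((1 - fps_X ^ ((m + 1) * (i + j + k - 1))) / (1 - fps_X ^ ((m + 1) * (i + j + k - 2))) :: rat fps)) =
         qs.box b c"
        unfolding qs.box_eq
      proof (intro prod.cong refl)
        fix i j k assume "i \<in> {1..a}" "j \<in> {1..b}" "k \<in> {1..c}"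
        \<comment> \<open>All three indices start at \<open>1\<close>, so the denominator has
          constant term \<open>1\<close> and the power series quotient is exact.\<close>
        then have "(m + 1) * (i + j + k - 2) > 0" by auto
        from div[OF this]
        show "fps_to_fls ((1 - fps_X ^ ((m + 1) * (i + j + k - 1))) / (1 - fps_X ^ ((m + 1) * (i + j + k - 2))) :: rat fps) =
          (1 - fls_X ^ ((m + 1) * (i + j + k - 1))) / (1 - fls_X ^ ((m + 1) * (i + j + k - 2)))"
          by (simp only: fps_to_fls_one_minus_X_power)
      qed
      moreover have "(\<Prod>u\<in>diagram lam - ?B. fps_to_fls (case u of (i, j) \<Rightarrow>
            1 / (1 - (fps_X :: rat fps) ^ hook_length lam i j))) =
         (\<Prod>(i, j)\<in>diagram lam - ?B. 1 / (1 - fls_X ^ hook_length lam i j))"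
        using hook by (intro prod.cong refl) (auto simp: div)
      ultimately show ?thesis
        by (simp only: g_def fps_to_fls_mult fps_to_fls_prod)
    qed
    finally show ?thesis .
  qed
  moreover have "fps_nth ?f N > 0" and "\<And>n. n < N \<Longrightarrow> fps_nth ?f n = 0"
  proof -
    \<comment> \<open>The removed rectangle occupies the first \<open>a\<close> cells of the first
      \<open>b\<close> columns, so those columns start below row \<open>a\<close>.\<close>
    let ?top = "\<lambda>j. if j \<le> b then a else 0"
    have cells: "?S = {(i, j). 1 \<le> j \<and> ?top j < i \<and> i \<le> conjugate lam j}"
      using conjugate_iff[OF part]
      by (auto simp: skew_diagram_def diagram_def assms(2) rect_def split: if_splits)
    have "?top j' \<le> ?top j" if "1 \<le> j" "j \<le> j'" for j j' using that by auto
    from SSYT_gf_subdegree[OF cells fin this assms(3)]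
    show "fps_nth ?f N > 0" and "\<And>n. n < N \<Longrightarrow> fps_nth ?f n = 0" by blast+
  qed
  ultimately have "?f = fps_X ^ N * g" using g0 by (intro fps_eq_of_assoc)
  then show ?thesis
    unfolding skew_schur_ps_eq_SSYT_gf[OF fin] g_def by (simp only: mult.assoc)
qed

end
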